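(* There exists a monomial ideal $I$ (in a polynomial ring $R$ over a field $\Bbbk$) such that the Taylor resolution of $R/I$, the Lyubeznik resolutions of $R/I$ and the Scarf complex of $I$ are all non-isomorphic to one another (i.e. the Taylor resolution, any Lyubeznik resolution, and the Scarf complex are pairwise non-isomorphic), and each of them is non-isomorphic to one of the Barile-Macchia resolutions of $R/I$ which is minimal.
   Context: Let $R=\Bbbk[x_1,\dots,x_N]$, $I\subseteq R$ a monomial ideal with minimal monomial generating set $\mathcal G(I)$, and $>_I$ a total ordering on $\mathcal G(I)$. The Taylor resolution $\mathcal F$ of $R/I$ has $\mathcal F_r$ free on the subsets of $\mathcal G(I)$ of cardinality $r$, with $\partial(\sigma)=\sum_{\sigma'\subseteq\sigma,|\sigma'|=|\sigma|-1}[\sigma:\sigma']\frac{\operatorname{lcm}(\sigma)}{\operatorname{lcm}(\sigma')}\sigma'$, where $[\sigma:\sigma']=\pm1$ are the simplicial boundary signs. The Scarf complex is the subcomplex of the Taylor resolution spanned by the subsets $\sigma$ such that $\operatorname{lcm}(\tau)\neq\operatorname{lcm}(\sigma)$ for all $\tau\ne\sigma$. Matchings. Let $G=(V,E)$ be the directed graph whose vertices are all subsets of $\mathcal G(I)$ and whose edges are the pairs $(\sigma,\sigma')$ with $\sigma'\subseteq\sigma$, $|\sigma'|=|\sigma|-1$; for $A\subseteq E$ let $G^A$ be obtained by reversing the edges in $A$. $A$ is an $\operatorname{lcm}$-homogeneous acyclic matching if every subset appears in at most one edge of $A$, $G^A$ has no directed cycle, and $\operatorname{lcm}(\sigma)=\operatorname{lcm}(\sigma')$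 for $(\sigma,\sigma')\in A$. Subsets in no edge of $A$ are critical. For an edge $(\sigma,\sigma')$ of $G^A$ put $m(\sigma,\sigma')=-[\sigma':\sigma]$ if $(\sigma',\sigma)\in A$, and $[\sigma:\sigma']$ otherwise; a gradient path $\mathcal P$ is a directed path in $G^A$ and $m(\mathcal P)$ is the product of the $m$'s of its edges. Such an $A$ induces a free resolution $\mathcal F_A$ of $R/I$ with $(\mathcal F_A)_r$ free on the critical subsets of cardinality $r$ and $$\partial_r^A(\sigma)=\sum_{\sigma'\subseteq\sigma,\,|\sigma'|=r-1}[\sigma:\sigma']\sum_{\sigma''\text{ critical},\,|\sigma''|=r-1}\ \sum_{\mathcal P:\sigma'\to\cdots\to\sigma''} m(\mathcal P)\frac{\operatorname{lcm}(\sigma)}{\operatorname{lcm}(\sigma'')}\sigma''.$$ Lyubeznik resolution (w.r.t. $>_I$). For $\sigma=\{m_1>_I\cdots>_Im_p\}$ let $v_L(\sigma)=\sup\{k\in[p]:\exists m\in\mathcal G(I),\ m_k>_Im,\ m\mid\operatorname{lcm}(m_1,\dots,m_k)\}$ ($-\infty$ if there is no such $k$); if $v_L(\sigma)\ne-\infty$ let $m_L(\sigma)$ be the $>_I$-smallest $m\in\mathcal G(I)$ with $m\mid\operatorname{lcm}(m_1,\dots,m_{v_L(\sigma)})$. The Lyubeznik resolution is $\mathcal F_A$ for $A=\{(\sigma\cup m_L(\sigma),\sigma\setminus m_L(\sigma)):v_L(\sigma)\ne-\infty\}$. Barile-Macchia resolution (w.r.t. $>_I$). $m$ is a bridge of $\sigma$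 if $m\in\sigma$ and $\operatorname{lcm}(\sigma\setminus m)=\operatorname{lcm}(\sigma)$; $\operatorname{sb}(\sigma)$ is the $>_I$-smallest bridge of $\sigma$, or $\emptyset$ if there is none ($\sigma\setminus\emptyset=\sigma$). Start with $A=\emptyset$, $\Omega=\{\sigma\subseteq\mathcal G(I):|\sigma|\ge3\}$. (1) Pick $\sigma\in\Omega$ of maximal cardinality. (2) Replace $\Omega$ by $\Omega\setminus\{\sigma,\sigma\setminus\operatorname{sb}(\sigma)\}$; if $\operatorname{sb}(\sigma)\ne\emptyset$ add $(\sigma,\sigma\setminus\operatorname{sb}(\sigma))$ to $A$; if $\Omega\ne\emptyset$ return to (1). (3) Whenever two distinct edges of $A$ have the same target, remove the one whose smallest bridge $\operatorname{sb}$ of its source is larger w.r.t. $>_I$. The Barile-Macchia resolution is $\mathcal F_A$ for the resulting $A$. Lyubeznik and Barile-Macchia resolutions depend on the choice of $>_I$. *)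

theory Defs
  imports "HOL-Algebra.Algebra" "HOL-Library.Poly_Mapping"
begin

text \<open>Monomials are exponent vectors in the variables indexed by the natural numbers, and the
  polynomial ring in \<open>N\<close> variables consists of the polynomials in which only the
  variables with index below \<open>N\<close> occur.\<close>

type_synonym mono = "nat \<Rightarrow>\<^sub>0 nat"
type_synonym 'k mpoly = "mono \<Rightarrow>\<^sub>0 'k"

definition monomials :: "nat \<Rightarrow> mono set" where
  "monomials N = {m. Poly_Mapping.keys m \<subseteq> {..<N}}"

definition mpoly_ring :: "nat \<Rightarrow> 'k::field mpoly ring" where
  "mpoly_ring N = \<lparr>carrier = {p. Poly_Mapping.keys p \<subseteq> monomials N},
     monoid.mult = (*), one = 1, ring.zero = 0, add = (+)\<rparr>"

abbreviation of_mono :: "mono \<Rightarrow> 'k::field mpoly" where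
  "of_mono m \<equiv> Poly_Mapping.single m 1"

definition irrelevant_ideal :: "nat \<Rightarrow> 'k::field mpoly set" where
  "irrelevant_ideal N =
     Idl\<^bsub>mpoly_ring N\<^esub> ((\<lambda>i. of_mono (Poly_Mapping.single i 1)) ` {..<N})"

definition mono_dvd :: "mono \<Rightarrow> mono \<Rightarrow> bool" where
  "mono_dvd m m' \<longleftrightarrow> (\<forall>i. Poly_Mapping.lookup m i \<le> Poly_Mapping.lookup m' i)"

text \<open>Only meaningful for finite sets; the lcm of the empty set is the monomial 1.\<close>

definition mono_lcm :: "mono set \<Rightarrow> mono" where
  "mono_lcm S = Abs_poly_mapping (\<lambda>i. Max (insert 0 ((\<lambda>m. Poly_Mapping.lookup m i) ` S)))"

definition monomial_ideal :: "nat \<Rightarrow> 'k::field mpoly set \<Rightarrow> bool" where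
  "monomial_ideal N I \<longleftrightarrow> (\<exists>S \<subseteq> monomials N. I = Idl\<^bsub>mpoly_ring N\<^esub> (of_mono ` S))"

definition minimal_generators :: "nat \<Rightarrow> 'k::field mpoly set \<Rightarrow> mono set \<Rightarrow> bool" where
  "minimal_generators N I G \<longleftrightarrow>
     G \<subseteq> monomials N \<and> Idl\<^bsub>mpoly_ring N\<^esub> (of_mono ` G) = I \<and>
     (\<forall>H. H \<subset> G \<longrightarrow> Idl\<^bsub>mpoly_ring N\<^esub> (of_mono ` H) \<noteq> I)"


section \<open>Complexes of modules\<close>

record ('a, 'b) module_complex =
  chain_mod :: "nat \<Rightarrow> ('a, 'b) module"
  bdry :: "nat \<Rightarrow> 'b \<Rightarrow> 'b"  \<comment> \<open>\<open>bdry C (Suc r)\<close> maps degree \<open>Suc r\<close> to degree \<open>r\<close>\<close>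

definition module_iso ::
  "('a, 'c) ring_scheme \<Rightarrow> ('a, 'b) module \<Rightarrow> ('a, 'd) module \<Rightarrow> ('b \<Rightarrow> 'd) set" where
  "module_iso R M M' = {h. bij_betw h (carrier M) (carrier M') \<and>
     (\<forall>x\<in>carrier M. \<forall>y\<in>carrier M. h (x \<oplus>\<^bsub>M\<^esub> y) = h x \<oplus>\<^bsub>M'\<^esub> h y) \<and>
     (\<forall>a\<in>carrier R. \<forall>x\<in>carrier M. h (a \<odot>\<^bsub>M\<^esub> x) = a \<odot>\<^bsub>M'\<^esub> h x)}"

definition complex_iso ::
  "('a, 'c) ring_scheme \<Rightarrow> ('a, 'b) module_complex \<Rightarrow> ('a, 'd) module_complex \<Rightarrow> bool" where
  "complex_iso R C D \<longleftrightarrow> (\<exists>h. (\<forall>r. h r \<in> module_iso R (chain_mod C r) (chain_mod D r)) \<and>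
     (\<forall>r. \<forall>x\<in>carrier (chain_mod C (Suc r)).
        h r (bdry C (Suc r) x) = bdry D (Suc r) (h (Suc r) x)))"

definition ideal_times_module ::
  "('a, 'c) ring_scheme \<Rightarrow> 'a set \<Rightarrow> ('a, 'b) module \<Rightarrow> 'b set" where
  "ideal_times_module R J M =
     \<Inter>{H. submodule H R M \<and> (\<forall>a\<in>J. \<forall>x\<in>carrier M. a \<odot>\<^bsub>M\<^esub> x \<in> H)}"

definition minimal_complex ::
  "('a, 'c) ring_scheme \<Rightarrow> 'a set \<Rightarrow> ('a, 'b) module_complex \<Rightarrow> bool" where
  "minimal_complex R J C \<longleftrightarrow>
     (\<forall>r. bdry C (Suc r) ` carrier (chain_mod C (Suc r)) \<subseteq> ideal_times_module R J (chain_mod C r))"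

text \<open>The free module with basis \<open>B\<close>; an element is its coordinate function, extended by 0. The
  fields \<open>mult\<close> and \<open>one\<close> of the record play no role for modules.\<close>

definition free_module :: "nat \<Rightarrow> 'b set \<Rightarrow> ('k::field mpoly, 'b \<Rightarrow> 'k mpoly) module" where
  "free_module N B =
     \<lparr>carrier = {f. (\<forall>b\<in>B. f b \<in> carrier (mpoly_ring N)) \<and> (\<forall>b. b \<notin> B \<longrightarrow> f b = 0)},
      monoid.mult = undefined, one = undefined,
      ring.zero = (\<lambda>_. 0), add = (\<lambda>f g b. f b + g b), smult = (\<lambda>a f b. a * f b)\<rparr>"

text \<open>The complex with bases \<open>B r\<close> in which the coefficient of \<open>b'\<close> in the boundary of the basis
  element \<open>b\<close> is \<open>c b b'\<close>.\<close>

definition based_complex ::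
  "nat \<Rightarrow> (nat \<Rightarrow> 'b set) \<Rightarrow> ('b \<Rightarrow> 'b \<Rightarrow> 'k::field mpoly) \<Rightarrow> ('k mpoly, 'b \<Rightarrow> 'k mpoly) module_complex" where
  "based_complex N B c =
     \<lparr>chain_mod = (\<lambda>r. free_module N (B r)),
      bdry = (\<lambda>r f b'. if r > 0 \<and> b' \<in> B (r - 1) then \<Sum>b\<in>B r. f b * c b b' else 0)\<rparr>"


section \<open>Taylor resolution and Scarf complex\<close>

text \<open>Throughout, \<open>gt\<close> is a strict total order on the set \<open>G\<close> of generators, and
  \<open>(m, m') \<in> gt\<close> means \<open>m >\<^sub>I m'\<close>. It also orients the simplices:
  for \<open>\<sigma> = {m\<^sub>1 >\<^sub>I \<dots> >\<^sub>I m\<^sub>p}\<close>, the face omitting \<open>m\<^sub>j\<close> has sign \<open>(-1)^(j-1)\<close>.\<close>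

definition facet :: "'m set \<Rightarrow> 'm set \<Rightarrow> bool" where
  "facet \<sigma> \<sigma>' \<longleftrightarrow> \<sigma>' \<subseteq> \<sigma> \<and> card \<sigma> = Suc (card \<sigma>')"

definition bsign :: "'m rel \<Rightarrow> 'm set \<Rightarrow> 'm set \<Rightarrow> int" where
  "bsign gt \<sigma> \<sigma>' = (- 1) ^ card {m \<in> \<sigma>. \<exists>m' \<in> \<sigma> - \<sigma>'. (m, m') \<in> gt}"

definition taylor :: "nat \<Rightarrow> mono set \<Rightarrow> mono rel \<Rightarrow> ('k::field mpoly, mono set \<Rightarrow> 'k mpoly) module_complex" where
  "taylor N G gt = based_complex N (\<lambda>r. {\<sigma>. \<sigma> \<subseteq> G \<and> card \<sigma> = r})
     (\<lambda>\<sigma> \<sigma>'. if facet \<sigma> \<sigma>'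
        then Poly_Mapping.single (mono_lcm \<sigma> - mono_lcm \<sigma>') (of_int (bsign gt \<sigma> \<sigma>')) else 0)"

definition scarf_sets :: "mono set \<Rightarrow> mono set set" where
  "scarf_sets G = {\<sigma>. \<sigma> \<subseteq> G \<and> (\<forall>\<tau>. \<tau> \<subseteq> G \<and> \<tau> \<noteq> \<sigma> \<longrightarrow> mono_lcm \<tau> \<noteq> mono_lcm \<sigma>)}"

definition scarf :: "nat \<Rightarrow> mono set \<Rightarrow> mono rel \<Rightarrow> ('k::field mpoly, mono set \<Rightarrow> 'k mpoly) module_complex" where
  "scarf N G gt = (taylor N G gt)
     \<lparr>chain_mod := (\<lambda>r. free_module N {\<sigma> \<in> scarf_sets G. card \<sigma> = r})\<rparr>"


section \<open>Resolutions induced by matchings\<close>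

definition taylor_edges :: "'m set \<Rightarrow> ('m set \<times> 'm set) set" where
  "taylor_edges G = {(\<sigma>, \<sigma>'). \<sigma> \<subseteq> G \<and> facet \<sigma> \<sigma>'}"

definition critical :: "'m set \<Rightarrow> ('m set \<times> 'm set) set \<Rightarrow> 'm set set" where
  "critical G A = {\<sigma>. \<sigma> \<subseteq> G \<and> (\<forall>e\<in>A. \<sigma> \<noteq> fst e \<and> \<sigma> \<noteq> snd e)}"

text \<open>A gradient path is given by its list of vertices; a single vertex is a path of weight 1.\<close>

definition gradient_paths ::
  "'m set \<Rightarrow> ('m set \<times> 'm set) set \<Rightarrow> 'm set \<Rightarrow> 'm set \<Rightarrow> 'm set list set" where
  "gradient_paths G A \<sigma> \<sigma>' = {P. P \<noteq> [] \<and> hd P = \<sigma> \<and> last P = \<sigma>' \<and>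
     successively (\<lambda>\<tau> \<tau>'. (\<tau>, \<tau>') \<in> (taylor_edges G - A) \<union> A\<inverse>) P}"

definition edge_weight :: "'m rel \<Rightarrow> ('m set \<times> 'm set) set \<Rightarrow> 'm set \<Rightarrow> 'm set \<Rightarrow> int" where
  "edge_weight gt A \<sigma> \<sigma>' = (if (\<sigma>', \<sigma>) \<in> A then - bsign gt \<sigma>' \<sigma> else bsign gt \<sigma> \<sigma>')"

definition path_weight :: "'m rel \<Rightarrow> ('m set \<times> 'm set) set \<Rightarrow> 'm set list \<Rightarrow> int" where
  "path_weight gt A P = (\<Prod>(\<tau>, \<tau>') \<leftarrow> zip P (tl P). edge_weight gt A \<tau> \<tau>')"

text \<open>Intended for homogeneous acyclic matchings \<open>A\<close>: acyclicity makes the sets of gradient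
  paths finite, and homogeneity makes the quotients of lcms below genuine monomials.\<close>

definition morse_complex ::
  "nat \<Rightarrow> mono set \<Rightarrow> mono rel \<Rightarrow> (mono set \<times> mono set) set
    \<Rightarrow> ('k::field mpoly, mono set \<Rightarrow> 'k mpoly) module_complex" where
  "morse_complex N G gt A = based_complex N (\<lambda>r. {\<sigma> \<in> critical G A. card \<sigma> = r})
     (\<lambda>\<sigma> \<sigma>''. \<Sum>\<sigma>' | facet \<sigma> \<sigma>'. \<Sum>P\<in>gradient_paths G A \<sigma>' \<sigma>''.
        Poly_Mapping.single (mono_lcm \<sigma> - mono_lcm \<sigma>'')
          (of_int (bsign gt \<sigma> \<sigma>' * path_weight gt A P)))"


section \<open>Lyubeznik resolutions\<close>

definition desc_list :: "'m rel \<Rightarrow> 'm set \<Rightarrow> 'm list" where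
  "desc_list gt \<sigma> = (THE xs. sorted_wrt (\<lambda>m m'. (m, m') \<in> gt) xs \<and> set xs = \<sigma>)"

definition smallest :: "'m rel \<Rightarrow> 'm set \<Rightarrow> 'm" where
  "smallest gt S = (THE m. m \<in> S \<and> (\<forall>m'\<in>S. m' \<noteq> m \<longrightarrow> (m', m) \<in> gt))"

text \<open>The set whose supremum is \<open>v\<^sub>L(\<sigma>)\<close>; the value \<open>-\<infinity>\<close> corresponds to this set being empty.
  List positions count from 0, so \<open>m\<^sub>k\<close> is the entry at position \<open>k - 1\<close>.\<close>

definition lyub_indices :: "mono set \<Rightarrow> mono rel \<Rightarrow> mono set \<Rightarrow> nat set" where
  "lyub_indices G gt \<sigma> = {k \<in> {1..card \<sigma>}. \<exists>m\<in>G.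
     (desc_list gt \<sigma> ! (k - 1), m) \<in> gt \<and>
     mono_dvd m (mono_lcm (set (take k (desc_list gt \<sigma>))))}"

definition lyub_v :: "mono set \<Rightarrow> mono rel \<Rightarrow> mono set \<Rightarrow> nat" where
  "lyub_v G gt \<sigma> = Max (lyub_indices G gt \<sigma>)"

definition lyub_m :: "mono set \<Rightarrow> mono rel \<Rightarrow> mono set \<Rightarrow> mono" where
  "lyub_m G gt \<sigma> = smallest gt
     {m \<in> G. mono_dvd m (mono_lcm (set (take (lyub_v G gt \<sigma>) (desc_list gt \<sigma>))))}"

definition lyub_matching :: "mono set \<Rightarrow> mono rel \<Rightarrow> (mono set \<times> mono set) set" where
  "lyub_matching G gt =
     {(\<sigma> \<union> {lyub_m G gt \<sigma>}, \<sigma> - {lyub_m G gt \<sigma>}) | \<sigma>. \<sigma> \<subseteq> G \<and> lyub_indices G gt \<sigma> \<noteq> {}}"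

definition lyubeznik ::
  "nat \<Rightarrow> mono set \<Rightarrow> mono rel \<Rightarrow> ('k::field mpoly, mono set \<Rightarrow> 'k mpoly) module_complex" where
  "lyubeznik N G gt = morse_complex N G gt (lyub_matching G gt)"


section \<open>Barile-Macchia resolutions\<close>

definition bridges :: "mono set \<Rightarrow> mono set" where
  "bridges \<sigma> = {m \<in> \<sigma>. mono_lcm (\<sigma> - {m}) = mono_lcm \<sigma>}"

text \<open>The smallest bridge, as a set with at most one element.\<close>

definition sb :: "mono rel \<Rightarrow> mono set \<Rightarrow> mono set" where
  "sb gt \<sigma> = (if bridges \<sigma> = {} then {} else {smallest gt (bridges \<sigma>)})"

text \<open>The pairs \<open>(\<Omega>, A)\<close> reachable by the algorithm before its pruning step; the element of maximal
  cardinality is chosen freely.\<close>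

inductive bm_state ::
  "mono set \<Rightarrow> mono rel \<Rightarrow> mono set set \<Rightarrow> (mono set \<times> mono set) set \<Rightarrow> bool"
  for G gt where
  init: "bm_state G gt {\<sigma>. \<sigma> \<subseteq> G \<and> card \<sigma> \<ge> 3} {}"
| step: "bm_state G gt \<Omega> A \<Longrightarrow> \<sigma> \<in> \<Omega> \<Longrightarrow> (\<And>\<tau>. \<tau> \<in> \<Omega> \<Longrightarrow> card \<tau> \<le> card \<sigma>) \<Longrightarrow>
    bm_state G gt (\<Omega> - {\<sigma>, \<sigma> - sb gt \<sigma>})
      (if sb gt \<sigma> = {} then A else insert (\<sigma>, \<sigma> - sb gt \<sigma>) A)"

text \<open>Removing, as long as two edges share a target, the one whose source has the larger smallest
  bridge leaves for each target exactly the edges not beaten by another one.\<close>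

definition bm_prune ::
  "mono rel \<Rightarrow> (mono set \<times> mono set) set \<Rightarrow> (mono set \<times> mono set) set" where
  "bm_prune gt A = {e \<in> A. \<not> (\<exists>e'\<in>A. e' \<noteq> e \<and> snd e' = snd e \<and>
     (\<exists>m \<in> sb gt (fst e). \<exists>m' \<in> sb gt (fst e'). (m, m') \<in> gt))}"

definition bm_matching :: "mono set \<Rightarrow> mono rel \<Rightarrow> (mono set \<times> mono set) set \<Rightarrow> bool" where
  "bm_matching G gt A \<longleftrightarrow> (\<exists>A'. bm_state G gt {} A' \<and> A = bm_prune gt A')"

definition barile_macchia ::
  "nat \<Rightarrow> mono set \<Rightarrow> mono rel \<Rightarrow> ('k::field mpoly, mono set \<Rightarrow> 'k mpoly) module_complex \<Rightarrow> bool" where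
  "barile_macchia N G gt C \<longleftrightarrow> (\<exists>A. bm_matching G gt A \<and> C = morse_complex N G gt A)"

end

theory Submission
  imports Defs
begin

text \<open>The example is the edge ideal of the five-cycle: five variables, and the five generators
  \<open>x\<^sub>i x\<^sub>i\<^sub>+\<^sub>1\<close> with indices modulo 5. The four kinds of complex already differ in their lengths,
  that is, in the largest degree in which the module is nonzero: the Taylor resolution has length 5,
  every Lyubeznik resolution has length 4, a suitable Barile-Macchia resolution has length 3, and
  the Scarf complex has length at most 2. An isomorphism of complexes matches the zero modules
  degree by degree, so ranks of free modules never have to be compared
  (lemma \<open>complex_iso_basis_empty_iff\<close>).

  All lcms are squarefree, so the lcm of a set of edges is the set of vertices that it covers. In
  particular an edge divides the lcm of a set of edges iff it belongs to the set or both of its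
  neighbours do (\<open>edge_dvd_lcm_edges_iff\<close>); the lengths are consequences of this one fact.

  For the Scarf complex, a set of at least three edges either contains an edge together with both
  its neighbours, and then loses no vertex when this edge is dropped, or it covers all vertices,
  as does the set of all edges.

  A set is critical for the Lyubeznik matching iff no generator divides the lcm of an upper part of
  the set while lying strictly below that part (\<open>critical_lyub_matching\<close>). For the five-cycle this
  means that the set does not contain both neighbours of an edge that is smaller than both of them,
  a local minimum of the order. The smallest edge is such a local minimum, so the set of all five
  edges is never critical. Two local minima are never adjacent, and any set of pairwise non-adjacent
  edges of a five-cycle has a common neighbour \<open>x\<close>; omitting \<open>x\<close> leaves four edges that form a
  critical set.

  The Barile-Macchia algorithm is run for the order in which edge 0 is the largest and edge 4 the
  smallest. Its matching leaves as critical sets the empty set, the five edges, the five pairs of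
  adjacent edges and one set of three edges. These cover 0, 2, 3 and 5 vertices respectively, so
  along each entry of a differential the degree of the lcm drops strictly, whatever the gradient
  paths contribute. Every entry therefore lies in the irrelevant ideal, and the resolution is
  minimal (\<open>minimal_morse_complex\<close>).\<close>

section \<open>Monomial ideals in the polynomial ring\<close>

lemma monomials_zero: "0 \<in> monomials N"
  by (simp add: monomials_def)

lemma monomials_add: "m \<in> monomials N \<Longrightarrow> m' \<in> monomials N \<Longrightarrow> m + m' \<in> monomials N"
  using keys_add[of m m'] by (auto simp: monomials_def)

lemma monomials_diff: "m \<in> monomials N \<Longrightarrow> m - m' \<in> monomials N"
proof -
  have "Poly_Mapping.keys (m - m') \<subseteq> Poly_Mapping.keys m"
    by (auto simp: in_keys_iff lookup_minus)
  then show "m \<in> monomials N \<Longrightarrow> m - m' \<in> monomials N"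
    by (auto simp: monomials_def)
qed

lemma mpoly_carrier_simps [simp]:
  "p \<in> carrier (mpoly_ring N) \<longleftrightarrow> Poly_Mapping.keys p \<subseteq> monomials N"
  "x \<otimes>\<^bsub>mpoly_ring N\<^esub> y = x * y" "x \<oplus>\<^bsub>mpoly_ring N\<^esub> y = x + y"
  "\<one>\<^bsub>mpoly_ring N\<^esub> = 1" "\<zero>\<^bsub>mpoly_ring N\<^esub> = 0"
  by (simp_all add: mpoly_ring_def)

lemma mpoly_carrier_mult:
  fixes p q :: "'k::field mpoly"
  assumes "Poly_Mapping.keys p \<subseteq> monomials N" "Poly_Mapping.keys q \<subseteq> monomials N"
  shows "Poly_Mapping.keys (p * q) \<subseteq> monomials N"
proof
  fix m assume "m \<in> Poly_Mapping.keys (p * q)"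
  then obtain a b where "m = a + b" "a \<in> Poly_Mapping.keys p" "b \<in> Poly_Mapping.keys q"
    using keys_mult[of p q] by blast
  then show "m \<in> monomials N" using assms monomials_add by blast
qed

lemma mpoly_carrier_add:
  fixes p q :: "'k::field mpoly"
  assumes "Poly_Mapping.keys p \<subseteq> monomials N" "Poly_Mapping.keys q \<subseteq> monomials N"
  shows "Poly_Mapping.keys (p + q) \<subseteq> monomials N"
  using keys_add[of p q] assms by blast

lemma mpoly_ring_cring: "cring (mpoly_ring N :: 'k::field mpoly ring)"
proof (rule cringI)
  show "abelian_group (mpoly_ring N :: 'k mpoly ring)"
  proof (rule abelian_groupI)
    fix x :: "'k mpoly" assume "x \<in> carrier (mpoly_ring N)"
    then show "\<exists>y\<in>carrier (mpoly_ring N). y \<oplus>\<^bsub>mpoly_ring N\<^esub> x = \<zero>\<^bsub>mpoly_ring N\<^esub>"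
      by (intro bexI[of _ "- x"]) (auto simp: in_keys_iff)
  qed (auto simp: mpoly_carrier_add algebra_simps)
  show "Group.comm_monoid (mpoly_ring N :: 'k mpoly ring)"
    by (rule comm_monoidI) (auto simp: mpoly_carrier_mult monomials_zero algebra_simps)
qed (auto simp: algebra_simps)

lemma mpoly_ring_ring: "ring (mpoly_ring N :: 'k::field mpoly ring)"
  using mpoly_ring_cring by (rule cring.axioms)

lemma minus_mpoly_ring:
  fixes x :: "'k::field mpoly"
  assumes "x \<in> carrier (mpoly_ring N)"
  shows "\<ominus>\<^bsub>mpoly_ring N\<^esub> x = - x"
proof -
  interpret ring "mpoly_ring N :: 'k mpoly ring" by (rule mpoly_ring_ring)
  have "- x \<in> carrier (mpoly_ring N)" using assms by auto
  then show ?thesis using assms minus_equality[of "- x" x] by simp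
qed

lemma mono_dvd_refl: "mono_dvd m m"
  by (simp add: mono_dvd_def)

lemma mono_dvd_add: "mono_dvd h m \<Longrightarrow> mono_dvd h (m' + m)"
  by (auto simp: mono_dvd_def lookup_add intro: trans_le_add2)

text \<open>If \<open>H\<close> consists of monomials of the ring, this is the ideal that they generate, described by
  supports. The description shows which monomials are not generated by \<open>H\<close>.\<close>

lemma multiples_ideal:
  "ideal {p \<in> carrier (mpoly_ring N :: 'k::field mpoly ring).
     \<forall>m\<in>Poly_Mapping.keys p. \<exists>h\<in>H. mono_dvd h m} (mpoly_ring N)" (is "ideal ?J ?R")
proof (rule idealI)
  show "ring ?R" by (rule mpoly_ring_ring)
  interpret R: ring ?R by (rule mpoly_ring_ring)
  show "subgroup ?J (add_monoid ?R)"
  proof (rule group.subgroupI)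
    show "group (add_monoid ?R)" by (rule R.a_group)
    fix a assume a: "a \<in> ?J"
    have "inv\<^bsub>add_monoid ?R\<^esub> a = - a"
      using minus_mpoly_ring[of a N] a unfolding a_inv_def by blast
    then show "inv\<^bsub>add_monoid ?R\<^esub> a \<in> ?J"
      using a by simp
  next
    fix a b assume a: "a \<in> ?J" "b \<in> ?J"
    then show "a \<otimes>\<^bsub>add_monoid ?R\<^esub> b \<in> ?J"
      using keys_add[of a b] by (auto simp: mpoly_carrier_add)
  next
    have "0 \<in> ?J" by simp
    then show "?J \<noteq> {}" by blast
  qed auto
  have mult: "x * a \<in> ?J" if "a \<in> ?J" "x \<in> carrier ?R" for a x
  proof -
    have "\<exists>h\<in>H. mono_dvd h m" if m: "m \<in> Poly_Mapping.keys (x * a)" for m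
    proof -
      obtain u v where uv: "m = u + v" "v \<in> Poly_Mapping.keys a"
        using m keys_mult[of x a] by blast
      then obtain h where "h \<in> H" "mono_dvd h v" using \<open>a \<in> ?J\<close> by blast
      then show ?thesis using mono_dvd_add uv(1) by blast
    qed
    then show ?thesis using that by (simp add: mpoly_carrier_mult)
  qed
  show "x \<otimes>\<^bsub>?R\<^esub> a \<in> ?J" if "a \<in> ?J" "x \<in> carrier ?R" for a x
    using mult[OF that] by simp
  show "a \<otimes>\<^bsub>?R\<^esub> x \<in> ?J" if "a \<in> ?J" "x \<in> carrier ?R" for a x
    using mult[OF that] by (simp add: mult.commute)
qed

text \<open>Dropping a generator \<open>g\<close> gives a smaller ideal, because the remaining ones generate a subset of
  the polynomials whose monomials are divisible by one of them, and none of them divides \<open>g\<close>.\<close>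

lemma minimal_generators_antichain:
  assumes G: "G \<subseteq> monomials N"
    and antichain: "\<And>g h. g \<in> G \<Longrightarrow> h \<in> G \<Longrightarrow> mono_dvd h g \<Longrightarrow> h = g"
  shows "minimal_generators N (Idl\<^bsub>mpoly_ring N\<^esub> (of_mono ` G) :: 'k::field mpoly set) G"
  unfolding minimal_generators_def
proof (intro conjI allI impI G refl)
  fix H assume H: "H \<subset> G"
  interpret R: ring "mpoly_ring N :: 'k mpoly ring" by (rule mpoly_ring_ring)
  let ?J = "{p \<in> carrier (mpoly_ring N :: 'k mpoly ring).
     \<forall>m\<in>Poly_Mapping.keys p. \<exists>h\<in>H. mono_dvd h m}"
  obtain g where g: "g \<in> G" "g \<notin> H" using H by blast
  have "of_mono h \<in> ?J" if "h \<in> H" for h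
    using H G that by (auto intro: mono_dvd_refl)
  then have "of_mono ` H \<subseteq> ?J" by blast
  then have "Idl\<^bsub>mpoly_ring N\<^esub> (of_mono ` H) \<subseteq> ?J"
    by (intro R.genideal_minimal multiples_ideal)
  moreover have "of_mono g \<notin> ?J"
    using g antichain H by auto
  moreover have "of_mono g \<in> Idl\<^bsub>mpoly_ring N\<^esub> (of_mono ` G :: 'k mpoly set)"
    by (rule subsetD[OF R.genideal_self]) (use G g in auto)
  ultimately show "Idl\<^bsub>mpoly_ring N\<^esub> (of_mono ` H) \<noteq> (Idl\<^bsub>mpoly_ring N\<^esub> (of_mono ` G) :: 'k mpoly set)"
    by blast
qed

lemma irrelevant_ideal_ideal: "ideal (irrelevant_ideal N) (mpoly_ring N :: 'k::field mpoly ring)"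
proof -
  interpret R: ring "mpoly_ring N :: 'k mpoly ring" by (rule mpoly_ring_ring)
  show ?thesis unfolding irrelevant_ideal_def
    by (rule R.genideal_ideal) (auto simp: monomials_def)
qed

text \<open>A monomial other than 1 is a multiple of one of the variables.\<close>

lemma single_in_irrelevant_ideal:
  assumes m: "m \<in> monomials N" "m \<noteq> 0"
  shows "Poly_Mapping.single m (c :: 'k::field) \<in> irrelevant_ideal N"
proof -
  interpret R: ring "mpoly_ring N :: 'k mpoly ring" by (rule mpoly_ring_ring)
  interpret J: ideal "irrelevant_ideal N" "mpoly_ring N :: 'k mpoly ring"
    by (rule irrelevant_ideal_ideal)
  obtain i where i: "i \<in> Poly_Mapping.keys m" using m(2) by (meson equals0I keys_eq_empty)
  with m have iN: "i < N" by (auto simp: monomials_def)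
  define x where "x = Poly_Mapping.single i (1::nat)"
  have "of_mono x \<in> (irrelevant_ideal N :: 'k mpoly set)"
    unfolding irrelevant_ideal_def x_def
    by (rule subsetD[OF R.genideal_self]) (use iN in \<open>auto simp: monomials_def\<close>)
  moreover have "Poly_Mapping.single (m - x) c \<in> carrier (mpoly_ring N)"
    using monomials_diff[OF m(1)] by auto
  moreover have "m - x + x = m"
    using i by (intro poly_mapping_eqI)
      (auto simp: lookup_add lookup_minus x_def lookup_single when_def in_keys_iff)
  ultimately show ?thesis
    using J.I_l_closed[of "of_mono x" "Poly_Mapping.single (m - x) c"] by (simp add: mult_single)
qed

section \<open>Complexes of free modules\<close>

lemma free_module_carrier:
  "f \<in> carrier (free_module N B) \<longleftrightarrow>
     (\<forall>b\<in>B. f b \<in> carrier (mpoly_ring N)) \<and> (\<forall>b. b \<notin> B \<longrightarrow> f b = 0)"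
  by (simp add: free_module_def)

text \<open>Having just one element is a property of the underlying set, so it is preserved by every
  bijection.\<close>

lemma free_module_trivial_iff:
  "(\<exists>z. carrier (free_module N B :: ('k::field mpoly, 'b \<Rightarrow> 'k mpoly) module) = {z}) \<longleftrightarrow> B = {}"
proof
  assume "\<exists>z. carrier (free_module N B :: ('k mpoly, 'b \<Rightarrow> 'k mpoly) module) = {z}"
  then obtain z where z: "carrier (free_module N B :: ('k mpoly, 'b \<Rightarrow> 'k mpoly) module) = {z}" ..
  show "B = {}"
  proof (rule ccontr)
    assume "B \<noteq> {}"
    then obtain b where "b \<in> B" by blast
    then have "(\<lambda>_. 0) \<in> carrier (free_module N B :: ('k mpoly, 'b \<Rightarrow> 'k mpoly) module)"
      "(\<lambda>b'. if b' = b then 1 else 0) \<in> carrier (free_module N B :: ('k mpoly, 'b \<Rightarrow> 'k mpoly) module)"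
      by (auto simp: free_module_carrier monomials_zero)
    then have "(\<lambda>b'. if b' = b then 1 else 0) = (\<lambda>_. 0 :: 'k mpoly)" unfolding z by simp
    then show False by (metis zero_neq_one)
  qed
next
  assume "B = {}"
  then have "carrier (free_module N B :: ('k mpoly, 'b \<Rightarrow> 'k mpoly) module) = {\<lambda>_. 0}"
    by (auto simp: free_module_carrier)
  then show "\<exists>z. carrier (free_module N B :: ('k mpoly, 'b \<Rightarrow> 'k mpoly) module) = {z}" by blast
qed

text \<open>The only obstruction to isomorphism that the comparison of the complexes uses.\<close>

lemma complex_iso_basis_empty_iff:
  fixes C D :: "('k::field mpoly, 'b \<Rightarrow> 'k mpoly) module_complex"
  assumes "complex_iso R C D"
    and "chain_mod C r = free_module N B" "chain_mod D r = free_module N B'"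
  shows "B = {} \<longleftrightarrow> B' = {}"
proof -
  obtain h where "bij_betw (h r) (carrier (chain_mod C r)) (carrier (chain_mod D r))"
    using assms(1) by (auto simp: complex_iso_def module_iso_def)
  then have h: "h r ` carrier (free_module N B) = carrier (free_module N B')"
     "inj_on (h r) (carrier (free_module N B))"
    using assms by (auto simp: bij_betw_def)
  have "(\<exists>z. carrier (free_module N B :: ('k mpoly, 'b \<Rightarrow> 'k mpoly) module) = {z}) \<longleftrightarrow>
     (\<exists>z. carrier (free_module N B' :: ('k mpoly, 'b \<Rightarrow> 'k mpoly) module) = {z})"
  proof
    assume "\<exists>z. carrier (free_module N B' :: ('k mpoly, 'b \<Rightarrow> 'k mpoly) module) = {z}"
    then obtain z where "h r ` carrier (free_module N B) = {z}" using h by auto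
    then show "\<exists>z. carrier (free_module N B :: ('k mpoly, 'b \<Rightarrow> 'k mpoly) module) = {z}"
      using h(2) by (metis card_image card_1_singleton_iff)
  qed (auto simp: h(1)[symmetric])
  then show ?thesis unfolding free_module_trivial_iff .
qed

lemma chain_mod_taylor: "chain_mod (taylor N G gt) r = free_module N {\<sigma>. \<sigma> \<subseteq> G \<and> card \<sigma> = r}"
  by (simp add: taylor_def based_complex_def)

lemma chain_mod_scarf: "chain_mod (scarf N G gt) r = free_module N {\<sigma> \<in> scarf_sets G. card \<sigma> = r}"
  by (simp add: scarf_def)

lemma chain_mod_morse:
  "chain_mod (morse_complex N G gt A) r = free_module N {\<sigma> \<in> critical G A. card \<sigma> = r}"
  by (simp add: morse_complex_def based_complex_def)

lemma chain_mod_lyubeznik: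
  "chain_mod (lyubeznik N G gt) r = free_module N {\<sigma> \<in> critical G (lyub_matching G gt). card \<sigma> = r}"
  by (simp add: lyubeznik_def chain_mod_morse)

text \<open>The boundary of an element is a finite sum of multiples of basis elements whose coefficients
  are entries of the matrix, hence elements of \<open>J\<close>.\<close>

lemma minimal_based_complex:
  fixes c :: "'b \<Rightarrow> 'b \<Rightarrow> 'k::field mpoly"
  assumes fin: "\<And>r. finite (B r)"
    and c: "\<And>r b b'. b \<in> B (Suc r) \<Longrightarrow> b' \<in> B r \<Longrightarrow> c b b' \<in> J"
  shows "minimal_complex (mpoly_ring N) J (based_complex N B c)"
  unfolding minimal_complex_def
proof (intro allI subsetI)
  fix r y
  let ?R = "mpoly_ring N :: 'k mpoly ring"
  let ?M = "free_module N (B r) :: ('k mpoly, 'b \<Rightarrow> 'k mpoly) module"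
  assume "y \<in> bdry (based_complex N B c) (Suc r) ` carrier (chain_mod (based_complex N B c) (Suc r))"
  then obtain f where f: "f \<in> carrier (free_module N (B (Suc r)))"
    and y: "y = (\<lambda>b'. if b' \<in> B r then \<Sum>b\<in>B (Suc r). f b * c b b' else 0)"
    by (auto simp: based_complex_def)
  have "y \<in> H" if H: "submodule H ?R ?M" and JH: "\<forall>a\<in>J. \<forall>x\<in>carrier ?M. a \<odot>\<^bsub>?M\<^esub> x \<in> H" for H
  proof -
    have zero: "(\<lambda>_. 0) \<in> H"
      using subgroup.one_closed[OF submodule.axioms(1)[OF H]] by (simp add: free_module_def)
    have add: "(\<lambda>b. u b + v b) \<in> H" if "u \<in> H" "v \<in> H" for u v
      using subgroup.m_closed[OF submodule.axioms(1)[OF H] that] by (simp add: free_module_def)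
    have sum: "(\<lambda>b. \<Sum>i\<in>S. u i b) \<in> H" if "finite S" "\<And>i. i \<in> S \<Longrightarrow> u i \<in> H"
      for S and u :: "'b \<Rightarrow> 'b \<Rightarrow> 'k mpoly"
      using that by (induction S rule: finite_induct) (auto simp: zero intro: add)
    have basic: "(\<lambda>b''. if b'' = b' then f b * c b b' else 0) \<in> H"
      if "b \<in> B (Suc r)" "b' \<in> B r" for b b'
    proof -
      have "(\<lambda>b''. if b'' = b' then f b else 0) \<in> carrier ?M"
        using f that by (auto simp: free_module_carrier)
      with JH c[OF that]
      have "c b b' \<odot>\<^bsub>?M\<^esub> (\<lambda>b''. if b'' = b' then f b else 0) \<in> H" by blast
      also have "c b b' \<odot>\<^bsub>?M\<^esub> (\<lambda>b''. if b'' = b' then f b else 0) =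
          (\<lambda>b''. if b'' = b' then f b * c b b' else 0)"
        by (auto simp: free_module_def)
      finally show ?thesis .
    qed
    have "(\<lambda>b''. \<Sum>b'\<in>B r. \<Sum>b\<in>B (Suc r). if b'' = b' then f b * c b b' else 0) \<in> H"
      by (intro sum fin basic)
    also have "(\<lambda>b''. \<Sum>b'\<in>B r. \<Sum>b\<in>B (Suc r). if b'' = b' then f b * c b b' else 0) = y"
      unfolding y
    proof
      fix b''
      have "(\<Sum>b'\<in>B r. \<Sum>b\<in>B (Suc r). if b'' = b' then f b * c b b' else 0) =
          (\<Sum>b'\<in>B r. if b'' = b' then \<Sum>b\<in>B (Suc r). f b * c b b' else 0)"
        by (intro sum.cong) auto
      then show "(\<Sum>b'\<in>B r. \<Sum>b\<in>B (Suc r). if b'' = b' then f b * c b b' else 0) =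
          (if b'' \<in> B r then \<Sum>b\<in>B (Suc r). f b * c b b'' else 0)"
        by (simp add: fin)
    qed
    finally show ?thesis .
  qed
  then show "y \<in> ideal_times_module ?R J (chain_mod (based_complex N B c) r)"
    by (auto simp: ideal_times_module_def based_complex_def)
qed

lemma sum_single_same:
  "(\<Sum>x\<in>S. Poly_Mapping.single m (g x)) = Poly_Mapping.single m (\<Sum>x\<in>S. g x)"
  by (induction S rule: infinite_finite_induct) (auto simp: single_add)

text \<open>All gradient paths that enter the coefficient of \<open>\<sigma>''\<close> in \<open>\<partial>(\<sigma>)\<close> contribute multiples of
  \<open>lcm(\<sigma>) / lcm(\<sigma>'')\<close>, so minimality needs no knowledge of the paths, only that this monomial is not
  1. As subtraction of exponents is truncated at 0, the hypothesis is stated as non-divisibility.\<close>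

lemma minimal_morse_complex:
  assumes G: "finite G" "\<And>\<sigma>. \<sigma> \<subseteq> G \<Longrightarrow> mono_lcm \<sigma> \<in> monomials N"
    and strict: "\<And>\<sigma> \<sigma>''. \<sigma> \<in> critical G A \<Longrightarrow> \<sigma>'' \<in> critical G A \<Longrightarrow> card \<sigma> = Suc (card \<sigma>'') \<Longrightarrow>
       \<not> mono_dvd (mono_lcm \<sigma>) (mono_lcm \<sigma>'')"
  shows "minimal_complex (mpoly_ring N) (irrelevant_ideal N :: 'k::field mpoly set) (morse_complex N G gt A)"
  unfolding morse_complex_def
proof (rule minimal_based_complex)
  fix r
  have "critical G A \<subseteq> Pow G" by (auto simp: critical_def)
  then show "finite {\<sigma> \<in> critical G A. card \<sigma> = r}"
    using G(1) finite_subset[of _ "Pow G"] by auto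
next
  fix r \<sigma> \<sigma>''
  assume s: "\<sigma> \<in> {\<sigma> \<in> critical G A. card \<sigma> = Suc r}" "\<sigma>'' \<in> {\<sigma> \<in> critical G A. card \<sigma> = r}"
  let ?m = "mono_lcm \<sigma> - mono_lcm \<sigma>''"
  have "mono_lcm \<sigma> \<in> monomials N" using s G by (auto simp: critical_def)
  then have "?m \<in> monomials N" by (rule monomials_diff)
  moreover have "?m \<noteq> 0"
  proof
    assume "?m = 0"
    then have "Poly_Mapping.lookup ?m i = 0" for i by simp
    then have "mono_dvd (mono_lcm \<sigma>) (mono_lcm \<sigma>'')"
      by (simp add: mono_dvd_def lookup_minus)
    then show False using strict s by auto
  qed
  ultimately show "(\<Sum>\<sigma>' | facet \<sigma> \<sigma>'. \<Sum>P\<in>gradient_paths G A \<sigma>' \<sigma>''.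
      Poly_Mapping.single ?m (of_int (bsign gt \<sigma> \<sigma>' * path_weight gt A P)))
      \<in> (irrelevant_ideal N :: 'k mpoly set)"
    unfolding sum_single_same by (rule single_in_irrelevant_ideal)
qed

section \<open>Strict linear orders on finite sets\<close>

lemma asymD_trans_irrefl: "trans r \<Longrightarrow> irrefl r \<Longrightarrow> (a, b) \<in> r \<Longrightarrow> (b, a) \<notin> r"
  by (metis irreflD transD)

lemma strict_linear_orderD:
  assumes "strict_linear_order_on G gt"
  shows "trans gt" "irrefl gt" "total_on G gt"
    and "(a, b) \<in> gt \<Longrightarrow> (b, a) \<notin> gt" and "(a, a) \<notin> gt"
    and "(a, b) \<in> gt \<Longrightarrow> (b, c) \<in> gt \<Longrightarrow> (a, c) \<in> gt"
proof -
  show o: "trans gt" "irrefl gt" "total_on G gt"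
    using assms unfolding strict_linear_order_on_def by blast+
  show "(a, b) \<in> gt \<Longrightarrow> (b, a) \<notin> gt" by (rule asymD_trans_irrefl[OF o(1,2)])
  show "(a, a) \<notin> gt" using o(2) by (rule irreflD)
  show "(a, b) \<in> gt \<Longrightarrow> (b, c) \<in> gt \<Longrightarrow> (a, c) \<in> gt" using o(1) by (rule transD)
qed

lemma ex_smallest:
  assumes "trans gt" "irrefl gt" "total_on G gt" "finite S" "S \<noteq> {}" "S \<subseteq> G"
  shows "\<exists>m\<in>S. \<forall>m'\<in>S. m' \<noteq> m \<longrightarrow> (m', m) \<in> gt"
  using assms(4-6)
proof (induction S rule: finite_ne_induct)
  case (singleton x)
  then show ?case by simp
next
  case (insert x F)
  then obtain m where m: "m \<in> F" "\<forall>m'\<in>F. m' \<noteq> m \<longrightarrow> (m', m) \<in> gt" by blast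
  have "(x, m) \<in> gt \<or> (m, x) \<in> gt"
    using insert m assms(3) by (metis insert_subset subsetD total_on_def)
  then show ?case
  proof
    assume "(x, m) \<in> gt"
    then show ?thesis using m by (intro bexI[of _ m]) auto
  next
    assume "(m, x) \<in> gt"
    have "(m', x) \<in> gt" if "m' \<in> F" for m'
      using m(2) that \<open>(m, x) \<in> gt\<close> transD[OF assms(1)] by metis
    then show ?thesis by (intro bexI[of _ x]) auto
  qed
qed

lemma smallest_eqI:
  assumes "trans gt" "irrefl gt" "m \<in> S" "\<And>m'. m' \<in> S \<Longrightarrow> m' \<noteq> m \<Longrightarrow> (m', m) \<in> gt"
  shows "smallest gt S = m"
  unfolding smallest_def
proof (rule the_equality)
  fix m' assume m': "m' \<in> S \<and> (\<forall>m''\<in>S. m'' \<noteq> m' \<longrightarrow> (m'', m') \<in> gt)"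
  then show "m' = m"
    using assms(3,4) asymD_trans_irrefl[OF assms(1,2)] by metis
qed (use assms in auto)

lemma smallest_props:
  assumes gt: "strict_linear_order_on G gt" and S: "finite S" "S \<noteq> {}" "S \<subseteq> G"
  shows "smallest gt S \<in> S" "\<And>m'. m' \<in> S \<Longrightarrow> m' \<noteq> smallest gt S \<Longrightarrow> (m', smallest gt S) \<in> gt"
proof -
  note o = strict_linear_orderD(1-3)[OF gt]
  obtain m where m: "m \<in> S" "\<forall>m'\<in>S. m' \<noteq> m \<longrightarrow> (m', m) \<in> gt"
    using ex_smallest[OF o S] by blast
  have "smallest gt S = m" using smallest_eqI[OF o(1,2) m(1)] m(2) by blast
  then show "smallest gt S \<in> S" "\<And>m'. m' \<in> S \<Longrightarrow> m' \<noteq> smallest gt S \<Longrightarrow> (m', smallest gt S) \<in> gt"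
    using m by auto
qed

lemma sorted_wrt_set_unique:
  assumes "trans r" "irrefl r"
  shows "sorted_wrt (\<lambda>x y. (x, y) \<in> r) xs \<Longrightarrow> sorted_wrt (\<lambda>x y. (x, y) \<in> r) ys \<Longrightarrow> set xs = set ys \<Longrightarrow> xs = ys"
proof (induction xs arbitrary: ys)
  case (Cons x xs)
  then obtain y ys' where ys: "ys = y # ys'" by (cases ys) auto
  note asym = asymD_trans_irrefl[OF assms]
  have "x = y"
  proof (rule ccontr)
    assume "x \<noteq> y"
    with Cons.prems ys have "(y, x) \<in> r" "(x, y) \<in> r" by auto
    then show False using asym by blast
  qed
  moreover have "x \<notin> set xs" "y \<notin> set ys'"
    using Cons.prems ys assms(2) by (auto simp: irrefl_def)
  then have "set xs = set ys'" using Cons.prems(3) ys \<open>x = y\<close> by auto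
  ultimately show ?case using Cons ys by auto
qed auto

text \<open>A new element is inserted between the elements that precede it and the others.\<close>

lemma ex_sorted_wrt:
  assumes "trans r" "total_on G r" "finite S" "S \<subseteq> G"
  shows "\<exists>xs. sorted_wrt (\<lambda>x y. (x, y) \<in> r) xs \<and> set xs = S"
  using assms(3,4)
proof (induction S rule: finite_induct)
  case (insert x F)
  then obtain xs where xs: "sorted_wrt (\<lambda>x y. (x, y) \<in> r) xs" "set xs = F" by auto
  let ?ys = "filter (\<lambda>y. (y, x) \<in> r) xs @ x # filter (\<lambda>y. (y, x) \<notin> r) xs"
  have cmp: "(x, y) \<in> r" if "y \<in> set xs" "(y, x) \<notin> r" for y
    using that insert xs assms(2) by (metis insert_subset subsetD total_on_def)
  have "sorted_wrt (\<lambda>x y. (x, y) \<in> r) ?ys"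
    using xs(1) cmp transD[OF assms(1)]
    by (auto simp: sorted_wrt_append intro: sorted_wrt_filter)
  moreover have "set ?ys = insert x F" using xs(2) by auto
  ultimately show ?case by blast
qed auto

lemma desc_list_props:
  assumes gt: "strict_linear_order_on G gt" and S: "finite \<sigma>" "\<sigma> \<subseteq> G"
  shows "sorted_wrt (\<lambda>m m'. (m, m') \<in> gt) (desc_list gt \<sigma>)" "set (desc_list gt \<sigma>) = \<sigma>"
    "length (desc_list gt \<sigma>) = card \<sigma>"
proof -
  note o = strict_linear_orderD(1-3)[OF gt]
  have "\<exists>!xs. sorted_wrt (\<lambda>m m'. (m, m') \<in> gt) xs \<and> set xs = \<sigma>"
    using ex_sorted_wrt[OF o(1,3) S] sorted_wrt_set_unique[OF o(1,2)] by blast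
  from theI'[OF this]
  show sorted: "sorted_wrt (\<lambda>m m'. (m, m') \<in> gt) (desc_list gt \<sigma>)" and set: "set (desc_list gt \<sigma>) = \<sigma>"
    unfolding desc_list_def by auto
  have "List.distinct xs" if "sorted_wrt (\<lambda>m m'. (m, m') \<in> gt) xs" for xs
    using that o(2) by (induction xs) (auto simp: irrefl_def)
  then show "length (desc_list gt \<sigma>) = card \<sigma>"
    using sorted set distinct_card by fastforce
qed

section \<open>Critical sets of the Lyubeznik matching\<close>

definition upper_part :: "'m rel \<Rightarrow> 'm set \<Rightarrow> 'm \<Rightarrow> 'm set" where
  "upper_part gt \<sigma> p = {q \<in> \<sigma>. q = p \<or> (q, p) \<in> gt}"

lemma upper_part_subset: "upper_part gt \<sigma> p \<subseteq> \<sigma>"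
  by (auto simp: upper_part_def)

text \<open>The prefixes of the decreasing enumeration are the upper parts of the set. This replaces
  positions in a list by elements, for which insertion and removal are easy to describe.\<close>

lemma set_take_desc_list:
  assumes gt: "strict_linear_order_on G gt" and S: "finite \<sigma>" "\<sigma> \<subseteq> G" and j: "j < card \<sigma>"
  shows "set (take (Suc j) (desc_list gt \<sigma>)) = upper_part gt \<sigma> (desc_list gt \<sigma> ! j)"
proof -
  let ?xs = "desc_list gt \<sigma>"
  note d = desc_list_props[OF gt S]
  note asym = strict_linear_orderD(4,5)[OF gt]
  have nth: "(?xs ! i, ?xs ! k) \<in> gt" if "i < k" "k < card \<sigma>" for i k
    using sorted_wrt_nth_less[OF d(1)] that d(3) by auto
  have iff: "i < Suc j \<longleftrightarrow> ?xs ! i = ?xs ! j \<or> (?xs ! i, ?xs ! j) \<in> gt" if "i < card \<sigma>" for i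
    using nth[of i j] nth[of j i] that j asym by (metis less_Suc_eq not_less_eq)
  have "set (take (Suc j) ?xs) = (!) ?xs ` {0..<Suc j}"
    using nth_image[of "Suc j" ?xs] j d(3) by simp
  also have "\<dots> = {?xs ! i | i. i < card \<sigma> \<and> i < Suc j}"
    using j by fastforce
  also have "\<dots> = upper_part gt \<sigma> (?xs ! j)"
  proof (intro equalityI subsetI)
    fix q assume "q \<in> {?xs ! i | i. i < card \<sigma> \<and> i < Suc j}"
    then obtain i where i: "i < card \<sigma>" "i < Suc j" "q = ?xs ! i" by blast
    then have "q \<in> \<sigma>" using nth_mem[of i ?xs] unfolding d(2,3) by blast
    then show "q \<in> upper_part gt \<sigma> (?xs ! j)" using iff[OF i(1)] i by (simp add: upper_part_def)
  next
    fix q assume q: "q \<in> upper_part gt \<sigma> (?xs ! j)"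
    then have "q \<in> set ?xs" unfolding d(2) by (simp add: upper_part_def)
    then obtain i where i: "i < card \<sigma>" "q = ?xs ! i" unfolding in_set_conv_nth d(3) by blast
    then show "q \<in> {?xs ! i | i. i < card \<sigma> \<and> i < Suc j}"
      using iff[OF i(1)] q by (auto simp: upper_part_def)
  qed
  finally show ?thesis .
qed

lemma lyub_indices_empty_iff:
  assumes gt: "strict_linear_order_on G gt" and S: "finite \<sigma>" "\<sigma> \<subseteq> G"
  shows "lyub_indices G gt \<sigma> = {} \<longleftrightarrow>
     (\<forall>p\<in>\<sigma>. \<forall>m\<in>G. (p, m) \<in> gt \<longrightarrow> \<not> mono_dvd m (mono_lcm (upper_part gt \<sigma> p)))"
proof -
  note d = desc_list_props[OF gt S]
  have mem: "Suc j \<in> lyub_indices G gt \<sigma> \<longleftrightarrow> j < card \<sigma> \<and>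
     (\<exists>m\<in>G. (desc_list gt \<sigma> ! j, m) \<in> gt \<and>
        mono_dvd m (mono_lcm (upper_part gt \<sigma> (desc_list gt \<sigma> ! j))))" for j
    using set_take_desc_list[OF gt S, of j] by (auto simp: lyub_indices_def)
  have "0 \<notin> lyub_indices G gt \<sigma>" by (simp add: lyub_indices_def)
  then have "lyub_indices G gt \<sigma> = {} \<longleftrightarrow> (\<forall>j. Suc j \<notin> lyub_indices G gt \<sigma>)"
    by (metis all_not_in_conv not0_implies_Suc)
  also have "\<dots> \<longleftrightarrow> (\<forall>p\<in>set (desc_list gt \<sigma>). \<forall>m\<in>G. (p, m) \<in> gt \<longrightarrow>
      \<not> mono_dvd m (mono_lcm (upper_part gt \<sigma> p)))"
    unfolding mem all_set_conv_all_nth d(3) by blast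
  finally show ?thesis unfolding d(2) .
qed

text \<open>The generator \<open>m = m\<^sub>L(\<sigma>)\<close> is the smallest one dividing the lcm of an upper part whose last
  element \<open>p\<close> lies strictly above some such divisor. Hence \<open>m\<close> lies strictly below \<open>p\<close>, and adding or
  removing \<open>m\<close> leaves this upper part, and with it the witness for \<open>v\<^sub>L \<noteq> -\<infinity>\<close>, untouched.\<close>

lemma lyub_indices_toggle:
  assumes gt: "strict_linear_order_on G gt" and G: "finite G"
    and S: "\<sigma> \<subseteq> G" "\<sigma>' \<subseteq> G" "lyub_indices G gt \<sigma> \<noteq> {}"
    and toggle: "\<sigma>' - {lyub_m G gt \<sigma>} = \<sigma> - {lyub_m G gt \<sigma>}"
  shows "lyub_indices G gt \<sigma>' \<noteq> {}"
proof -
  have fin: "finite \<sigma>" "finite \<sigma>'" using S(1,2) G by (simp_all add: finite_subset)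
  note d = desc_list_props[OF gt fin(1) S(1)]
  note asym = strict_linear_orderD(4,5)[OF gt] and trans = strict_linear_orderD(6)[OF gt]
  let ?m = "lyub_m G gt \<sigma>" and ?k = "lyub_v G gt \<sigma>"
  have "finite (lyub_indices G gt \<sigma>)" by (simp add: lyub_indices_def)
  then have "?k \<in> lyub_indices G gt \<sigma>" unfolding lyub_v_def using S(3) by (rule Max_in)
  then obtain j m0 where j: "?k = Suc j" "j < card \<sigma>" and m0: "m0 \<in> G"
     "(desc_list gt \<sigma> ! j, m0) \<in> gt" "mono_dvd m0 (mono_lcm (set (take ?k (desc_list gt \<sigma>))))"
    by (cases ?k) (auto simp: lyub_indices_def)
  define p where "p = desc_list gt \<sigma> ! j"
  \<comment> \<open>\<open>p\<close> is the last element of the upper part that defines \<open>m\<^sub>L(\<sigma>)\<close>, and \<open>D\<close> is the set of candidates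
    for \<open>m\<^sub>L(\<sigma>)\<close>.\<close>
  define D where "D = {m \<in> G. mono_dvd m (mono_lcm (upper_part gt \<sigma> p))}"
  have up: "set (take ?k (desc_list gt \<sigma>)) = upper_part gt \<sigma> p"
    using set_take_desc_list[OF gt fin(1) S(1) j(2)] j(1) by (simp add: p_def)
  have "m0 \<in> D" using m0 up by (simp add: D_def)
  have m: "?m = smallest gt D" unfolding lyub_m_def up D_def ..
  have D: "finite D" "D \<noteq> {}" "D \<subseteq> G" using G \<open>m0 \<in> D\<close> by (auto simp: D_def)
  have "?m \<in> D" "?m = m0 \<or> (m0, ?m) \<in> gt"
    using smallest_props[OF gt D] \<open>m0 \<in> D\<close> m by auto
  then have pm: "(p, ?m) \<in> gt" using m0(2) trans p_def by blast
  have "p \<in> \<sigma>" using nth_mem[of j "desc_list gt \<sigma>"] j(2) unfolding d(2,3) p_def by blast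
  then have "p \<in> \<sigma>'" using toggle pm asym by blast
  moreover have "upper_part gt \<sigma>' p = upper_part gt \<sigma> p"
    using toggle pm asym by (auto simp: upper_part_def)
  then have "?m \<in> G" "mono_dvd ?m (mono_lcm (upper_part gt \<sigma>' p))"
    using \<open>?m \<in> D\<close> by (auto simp: D_def)
  ultimately show ?thesis
    using pm unfolding lyub_indices_empty_iff[OF gt fin(2) S(2)] by blast
qed

text \<open>A set with \<open>v\<^sub>L \<noteq> -\<infinity>\<close> is an end of its own edge of the matching. Conversely both ends of an edge
  arise by adding or removing \<open>m\<^sub>L\<close>, so \<open>v\<^sub>L \<noteq> -\<infinity>\<close> holds for them as well. Hence being critical means
  \<open>v\<^sub>L = -\<infinity>\<close>.\<close>

lemma critical_lyub_matching:
  assumes gt: "strict_linear_order_on G gt" and G: "finite G"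
  shows "critical G (lyub_matching G gt) = {\<sigma>. \<sigma> \<subseteq> G \<and>
     (\<forall>p\<in>\<sigma>. \<forall>m\<in>G. (p, m) \<in> gt \<longrightarrow> \<not> mono_dvd m (mono_lcm (upper_part gt \<sigma> p)))}"
proof -
  have "critical G (lyub_matching G gt) = {\<sigma>. \<sigma> \<subseteq> G \<and> lyub_indices G gt \<sigma> = {}}"
  proof (intro equalityI subsetI)
    fix \<sigma> assume "\<sigma> \<in> critical G (lyub_matching G gt)"
    then have s: "\<sigma> \<subseteq> G" "\<And>e. e \<in> lyub_matching G gt \<Longrightarrow> \<sigma> \<noteq> fst e \<and> \<sigma> \<noteq> snd e"
      by (auto simp: critical_def)
    have "lyub_indices G gt \<sigma> = {}"
    proof (rule ccontr)
      let ?m = "lyub_m G gt \<sigma>"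
      assume "lyub_indices G gt \<sigma> \<noteq> {}"
      then have "(\<sigma> \<union> {?m}, \<sigma> - {?m}) \<in> lyub_matching G gt"
        using s(1) by (auto simp: lyub_matching_def)
      from s(2)[OF this] show False by auto
    qed
    with s show "\<sigma> \<in> {\<sigma>. \<sigma> \<subseteq> G \<and> lyub_indices G gt \<sigma> = {}}" by simp
  next
    fix \<sigma> assume s: "\<sigma> \<in> {\<sigma>. \<sigma> \<subseteq> G \<and> lyub_indices G gt \<sigma> = {}}"
    have "\<sigma> \<noteq> fst e \<and> \<sigma> \<noteq> snd e" if "e \<in> lyub_matching G gt" for e
    proof -
      obtain \<tau> where t: "\<tau> \<subseteq> G" "lyub_indices G gt \<tau> \<noteq> {}"
        "e = (\<tau> \<union> {lyub_m G gt \<tau>}, \<tau> - {lyub_m G gt \<tau>})"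
        using \<open>e \<in> lyub_matching G gt\<close> by (auto simp: lyub_matching_def)
      then show ?thesis
        using lyub_indices_toggle[OF gt G t(1) _ t(2), of \<sigma>] s by auto
    qed
    with s show "\<sigma> \<in> critical G (lyub_matching G gt)" by (simp add: critical_def)
  qed
  also have "\<dots> = {\<sigma>. \<sigma> \<subseteq> G \<and>
     (\<forall>p\<in>\<sigma>. \<forall>m\<in>G. (p, m) \<in> gt \<longrightarrow> \<not> mono_dvd m (mono_lcm (upper_part gt \<sigma> p)))}"
    using lyub_indices_empty_iff[OF gt] G finite_subset by blast
  finally show ?thesis .
qed

section \<open>Runs of the Barile-Macchia algorithm\<close>

text \<open>A certificate for the outcome of the algorithm. Let \<open>P\<close> be the family of sets that are picked
  in step (1); every other set of cardinality at least 3 is discarded as the target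
  \<open>p \<setminus> sb(p)\<close> of a picked one, and no picked set is the target of another. Picking the members of \<open>P\<close>
  by decreasing cardinality is then a legal run: a set still waiting is in \<open>P\<close> itself or a subset of
  a waiting member of \<open>P\<close>, so it is not larger than the set picked next. The claim proved by
  induction describes the state after processing any part \<open>Q\<close> of \<open>P\<close> that is closed under going to
  larger cardinalities.\<close>

lemma bm_state_processed:
  assumes G: "finite G"
    and P: "P \<subseteq> {\<sigma>. \<sigma> \<subseteq> G \<and> card \<sigma> \<ge> 3}"
    and cover: "\<And>\<sigma>. \<sigma> \<subseteq> G \<Longrightarrow> card \<sigma> \<ge> 3 \<Longrightarrow> \<sigma> \<notin> P \<Longrightarrow> \<exists>p\<in>P. \<sigma> = p - sb gt p"
    and excl: "\<And>p q. p \<in> P \<Longrightarrow> q \<in> P \<Longrightarrow> q \<noteq> p \<Longrightarrow> q \<noteq> p - sb gt p"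
  shows "bm_state G gt {} {(p, p - sb gt p) | p. p \<in> P \<and> sb gt p \<noteq> {}}"
proof -
  let ?\<Omega> = "{\<sigma>. \<sigma> \<subseteq> G \<and> card \<sigma> \<ge> 3}"
  let ?D = "\<lambda>Q. Q \<union> (\<lambda>p. p - sb gt p) ` Q"
  let ?E = "\<lambda>Q. {(p, p - sb gt p) | p. p \<in> Q \<and> sb gt p \<noteq> {}}"
  have finP: "finite P" using P G by (rule_tac finite_subset[of _ "Pow G"]) auto
  have "bm_state G gt (?\<Omega> - ?D Q) (?E Q)"
    if "Q \<subseteq> P" "\<And>p q. p \<in> P - Q \<Longrightarrow> q \<in> Q \<Longrightarrow> card p \<le> card q" for Q
    using that
  proof (induction "card Q" arbitrary: Q)
    case 0
    then have "Q = {}" using finP finite_subset by fastforce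
    then show ?case using bm_state.init[of G gt] by simp
  next
    case (Suc n)
    have finQ: "finite Q" "Q \<noteq> {}" using Suc.hyps(2) by (auto intro: card_ge_0_finite)
    \<comment> \<open>\<open>q\<close> is the set picked last among those in \<open>Q\<close>.\<close>
    define q where "q = arg_min_on card Q"
    have q: "q \<in> Q" "\<And>p. p \<in> Q \<Longrightarrow> card q \<le> card p"
      using arg_min_if_finite[OF finQ, of card] by (auto simp: q_def not_less)
    let ?Q = "Q - {q}"
    have small: "card p \<le> card q" if "p \<in> P - ?Q" for p
      using that q Suc.prems by blast
    have IH: "bm_state G gt (?\<Omega> - ?D ?Q) (?E ?Q)"
    proof (rule Suc.hyps(1))
      show "n = card ?Q" using Suc.hyps(2) q finQ by simp
      show "card p \<le> card q'" if "p \<in> P - ?Q" "q' \<in> ?Q" for p q'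
        using small[OF that(1)] q(2) that(2) by force
    qed (use Suc.prems in auto)
    have "q \<in> ?\<Omega> - ?D ?Q"
      using q Suc.prems(1) P excl by blast
    moreover have "card \<tau> \<le> card q" if t: "\<tau> \<in> ?\<Omega> - ?D ?Q" for \<tau>
    proof (cases "\<tau> \<in> P")
      case True
      with t small show ?thesis by blast
    next
      case False
      obtain p where p: "p \<in> P" "\<tau> = p - sb gt p" using cover[OF _ _ False] t by auto
      then have "p \<in> P - ?Q" using t by blast
      moreover have "finite p" using p P G finite_subset by blast
      then have "card \<tau> \<le> card p" using p(2) by (auto intro: card_mono)
      ultimately show ?thesis using small by force
    qed
    ultimately have "bm_state G gt (?\<Omega> - ?D ?Q - {q, q - sb gt q})
        (if sb gt q = {} then ?E ?Q else insert (q, q - sb gt q) (?E ?Q))"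
      by (rule bm_state.step[OF IH])
    moreover have "?\<Omega> - ?D ?Q - {q, q - sb gt q} = ?\<Omega> - ?D Q" using q by blast
    moreover have "(if sb gt q = {} then ?E ?Q else insert (q, q - sb gt q) (?E ?Q)) = ?E Q"
      using q by auto
    ultimately show ?case by simp
  qed
  from this[of P] have "bm_state G gt (?\<Omega> - ?D P) (?E P)" by blast
  moreover have "?\<Omega> - ?D P = {}" using cover by blast
  ultimately show ?thesis by simp
qed

text \<open>Step (3) of the algorithm does nothing if the targets are already distinct.\<close>

lemma bm_prune_inj:
  assumes "inj_on snd A" shows "bm_prune gt A = A"
  using inj_onD[OF assms] unfolding bm_prune_def by blast

section \<open>The edge ideal of the five-cycle\<close>

text \<open>The pointwise maximum of finitely many exponent vectors has finite support, so it is the exponent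
  vector that the definition of the lcm asks for.\<close>

lemma lookup_mono_lcm:
  assumes "finite S"
  shows "Poly_Mapping.lookup (mono_lcm S) i = Max (insert 0 ((\<lambda>m. Poly_Mapping.lookup m i) ` S))"
proof -
  have "{i. Max (insert 0 ((\<lambda>m. Poly_Mapping.lookup m i) ` S)) \<noteq> 0} \<subseteq> (\<Union>m\<in>S. Poly_Mapping.keys m)"
  proof
    fix i assume "i \<in> {i. Max (insert 0 ((\<lambda>m. Poly_Mapping.lookup m i) ` S)) \<noteq> 0}"
    moreover have "Max (insert 0 ((\<lambda>m. Poly_Mapping.lookup m i) ` S)) \<in> insert 0 ((\<lambda>m. Poly_Mapping.lookup m i) ` S)"
      using assms by (intro Max_in) auto
    ultimately show "i \<in> (\<Union>m\<in>S. Poly_Mapping.keys m)" by (auto simp: in_keys_iff)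
  qed
  then have "finite {i. Max (insert 0 ((\<lambda>m. Poly_Mapping.lookup m i) ` S)) \<noteq> 0}"
    using assms by (elim finite_subset) auto
  then show ?thesis unfolding mono_lcm_def by (simp add: Abs_poly_mapping_inverse)
qed

definition cyc_next :: "nat \<Rightarrow> nat" where "cyc_next i = (i + 1) mod 5"

definition cyc_prev :: "nat \<Rightarrow> nat" where "cyc_prev i = (i + 4) mod 5"

definition edge :: "nat \<Rightarrow> mono" where
  "edge i = Poly_Mapping.single i 1 + Poly_Mapping.single (cyc_next i) 1"

definition cycle_edges :: "mono set" where "cycle_edges = edge ` {..<5}"

text \<open>The vertices covered by a set of edges; edge \<open>i\<close> joins the vertices \<open>i\<close> and \<open>cyc_next i\<close>.\<close>

definition verts :: "nat set \<Rightarrow> nat set" where "verts S = S \<union> cyc_next ` S"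

lemma less5: "{..<5} = {0, 1, 2, 3, 4 :: nat}"
  by auto

lemma cyc_next_prev:
  assumes "i < 5"
  shows "cyc_next i < 5" "cyc_prev i < 5" "cyc_next i \<noteq> i" "cyc_prev i \<noteq> i"
    "cyc_next (cyc_prev i) = i" "cyc_prev (cyc_next i) = i" "cyc_prev i \<noteq> cyc_next i"
proof -
  have "i = 0 \<or> i = 1 \<or> i = 2 \<or> i = 3 \<or> i = 4" using assms by linarith
  then show "cyc_next i < 5" "cyc_prev i < 5" "cyc_next i \<noteq> i" "cyc_prev i \<noteq> i"
    "cyc_next (cyc_prev i) = i" "cyc_prev (cyc_next i) = i" "cyc_prev i \<noteq> cyc_next i"
    by (auto simp: cyc_next_def cyc_prev_def)
qed

lemma lookup_edge:
  assumes "i < 5"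
  shows "Poly_Mapping.lookup (edge i) j = (if j = i \<or> j = cyc_next i then 1 else 0)"
  using cyc_next_prev(3)[OF assms] cyc_next_prev(3)[OF assms, symmetric]
  by (simp add: edge_def lookup_add lookup_single when_def)

lemma inj_edge: "inj_on edge {..<5}"
proof (rule inj_onI)
  fix i j :: nat assume ij: "i \<in> {..<5}" "j \<in> {..<5}" and eq: "edge i = edge j"
  then have "i = j \<or> i = cyc_next j" "j = i \<or> j = cyc_next i"
    using lookup_edge[of i i] lookup_edge[of j i] lookup_edge[of i j] lookup_edge[of j j]
    by (metis lessThan_iff zero_neq_one)+
  then show "i = j" using ij cyc_next_prev(6,7) by (metis lessThan_iff)
qed

lemma edge_eq_iff: "i < 5 \<Longrightarrow> j < 5 \<Longrightarrow> edge i = edge j \<longleftrightarrow> i = j"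
  using inj_edge by (auto simp: inj_on_def)

lemma edge_image_eq_iff:
  "S \<subseteq> {..<5} \<Longrightarrow> T \<subseteq> {..<5} \<Longrightarrow> edge ` S = edge ` T \<longleftrightarrow> S = T"
  by (rule inj_on_image_eq_iff[OF inj_edge])

lemma card_edge_image: "S \<subseteq> {..<5} \<Longrightarrow> card (edge ` S) = card S"
  using card_image inj_on_subset[OF inj_edge] by blast

text \<open>The lcm is squarefree: it is the product of the covered vertices.\<close>

lemma lookup_lcm_edges:
  assumes S: "S \<subseteq> {..<5}"
  shows "Poly_Mapping.lookup (mono_lcm (edge ` S)) j = (if j \<in> verts S then 1 else 0)"
proof -
  have fin: "finite S" using S finite_subset by blast
  have ex: "j \<in> verts S \<longleftrightarrow> (\<exists>i\<in>S. j = i \<or> j = cyc_next i)"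
    unfolding verts_def by blast
  have val: "Poly_Mapping.lookup (edge i) j = (if j = i \<or> j = cyc_next i then 1 else 0)" if "i \<in> S" for i
    using that S lookup_edge by blast
  let ?X = "insert 0 ((\<lambda>i. Poly_Mapping.lookup (edge i) j) ` S)"
  have "Max ?X = (if j \<in> verts S then 1 else 0)"
  proof (cases "j \<in> verts S")
    case True
    then obtain i where "i \<in> S" "j = i \<or> j = cyc_next i" using ex by blast
    then have "Poly_Mapping.lookup (edge i) j = 1" using val[of i] by simp
    with \<open>i \<in> S\<close> have "1 \<in> ?X" by (metis imageI insertCI)
    moreover have "y \<le> 1" if "y \<in> ?X" for y
      using that val by (elim insertE imageE) simp_all
    ultimately show ?thesis using True fin by (subst Max_eqI[of ?X 1]) auto
  next
    case False
    then have "?X = {0}" using val ex by auto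
    then have "Max ?X = 0" by (simp only: Max_singleton)
    then show ?thesis using False by simp
  qed
  then show ?thesis using lookup_mono_lcm[of "edge ` S" j] fin by (simp add: image_image)
qed

lemma lcm_edges_dvd_iff:
  assumes "S \<subseteq> {..<5}" "T \<subseteq> {..<5}"
  shows "mono_dvd (mono_lcm (edge ` S)) (mono_lcm (edge ` T)) \<longleftrightarrow> verts S \<subseteq> verts T"
  using assms by (auto simp: mono_dvd_def lookup_lcm_edges)

lemma lcm_edges_eq_iff:
  assumes "S \<subseteq> {..<5}" "T \<subseteq> {..<5}"
  shows "mono_lcm (edge ` S) = mono_lcm (edge ` T) \<longleftrightarrow> verts S = verts T"
proof
  assume "mono_lcm (edge ` S) = mono_lcm (edge ` T)"
  then have "j \<in> verts S \<longleftrightarrow> j \<in> verts T" for j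
    using assms by (metis lookup_lcm_edges zero_neq_one)
  then show "verts S = verts T" by blast
qed (use assms in \<open>auto intro!: poly_mapping_eqI simp: lookup_lcm_edges\<close>)

lemma mem_verts_iff:
  assumes "S \<subseteq> {..<5}" "i < 5"
  shows "i \<in> verts S \<longleftrightarrow> i \<in> S \<or> cyc_prev i \<in> S"
proof -
  have "i \<in> cyc_next ` S \<longleftrightarrow> cyc_prev i \<in> S"
    using assms cyc_next_prev(5,6) by (metis image_iff lessThan_iff subsetD)
  then show ?thesis unfolding verts_def by blast
qed

text \<open>Edge \<open>i\<close> meets only the edges before and after it, and each of these covers just one of its two
  end points.\<close>

lemma edge_dvd_lcm_edges_iff:
  assumes S: "S \<subseteq> {..<5}" and i: "i < 5"
  shows "mono_dvd (edge i) (mono_lcm (edge ` S)) \<longleftrightarrow> i \<in> S \<or> cyc_prev i \<in> S \<and> cyc_next i \<in> S"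
proof -
  have "mono_dvd (edge i) (mono_lcm (edge ` S)) \<longleftrightarrow> i \<in> verts S \<and> cyc_next i \<in> verts S"
    using i by (auto simp: mono_dvd_def lookup_edge lookup_lcm_edges[OF S])
  also have "\<dots> \<longleftrightarrow> i \<in> S \<or> cyc_prev i \<in> S \<and> cyc_next i \<in> S"
    using mem_verts_iff[OF S] cyc_next_prev[OF i] i by auto
  finally show ?thesis .
qed

lemma cycle_edges_monomials: "cycle_edges \<subseteq> monomials 5"
proof
  fix m assume "m \<in> cycle_edges"
  then obtain i where "i < 5" "m = edge i" by (auto simp: cycle_edges_def)
  then show "m \<in> monomials 5"
    using lookup_edge[of i] cyc_next_prev(1)[of i] by (auto simp: monomials_def in_keys_iff split: if_splits)
qed

lemma subset_cycle_edges:
  assumes "\<sigma> \<subseteq> cycle_edges"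
  obtains S where "S \<subseteq> {..<5}" "\<sigma> = edge ` S"
  using assms unfolding cycle_edges_def by (meson subset_imageE)

lemma finite_cycle_edges: "finite cycle_edges"
  by (simp add: cycle_edges_def)

lemma card_cycle_edges: "card cycle_edges = 5"
  by (simp add: cycle_edges_def card_edge_image)

lemma lcm_cycle_edges_monomials: "\<sigma> \<subseteq> cycle_edges \<Longrightarrow> mono_lcm \<sigma> \<in> monomials 5"
proof -
  assume "\<sigma> \<subseteq> cycle_edges"
  then obtain S where S: "S \<subseteq> {..<5}" "\<sigma> = edge ` S" by (rule subset_cycle_edges)
  then have "verts S \<subseteq> {..<5}" by (auto simp: verts_def cyc_next_def)
  then show "mono_lcm \<sigma> \<in> monomials 5"
    using S by (auto simp: monomials_def in_keys_iff lookup_lcm_edges split: if_splits)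
qed

lemma cycle_edges_antichain:
  assumes "g \<in> cycle_edges" "h \<in> cycle_edges" "mono_dvd h g"
  shows "h = g"
proof -
  obtain i j where ij: "i < 5" "g = edge i" "j < 5" "h = edge j"
    using assms by (auto simp: cycle_edges_def)
  have "j = i \<or> j = cyc_next i" "cyc_next j = i \<or> cyc_next j = cyc_next i"
    using assms(3) ij lookup_edge[of j j] lookup_edge[of j "cyc_next j"] lookup_edge[of i]
    by (auto simp: mono_dvd_def dest: spec[of _ j] spec[of _ "cyc_next j"] split: if_splits)
  then show ?thesis using ij cyc_next_prev by metis
qed

lemma edge_dvd_lcm_iff:
  assumes \<tau>: "\<tau> \<subseteq> cycle_edges" and i: "i < 5"
  shows "mono_dvd (edge i) (mono_lcm \<tau>) \<longleftrightarrow>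
     edge i \<in> \<tau> \<or> edge (cyc_prev i) \<in> \<tau> \<and> edge (cyc_next i) \<in> \<tau>"
proof -
  obtain T where T: "T \<subseteq> {..<5}" "\<tau> = edge ` T" using \<tau> by (rule subset_cycle_edges)
  have "edge j \<in> \<tau> \<longleftrightarrow> j \<in> T" if "j < 5" for j
    using that T inj_on_image_mem_iff[OF inj_edge, of j T] by auto
  then show ?thesis using edge_dvd_lcm_edges_iff[OF T(1) i] T(2) cyc_next_prev(1,2)[OF i] i by simp
qed

section \<open>Scarf sets of the five-cycle\<close>

text \<open>A set \<open>S\<close> of at least three edges shares its lcm with the set of all edges or with some
  \<open>S \<setminus> {i}\<close>. The 32 sets of edges are checked one by one.\<close>

lemma scarf_sets_cycle_edges:
  assumes "\<sigma> \<in> scarf_sets cycle_edges"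
  shows "card \<sigma> \<le> 2"
proof (rule ccontr)
  assume c: "\<not> card \<sigma> \<le> 2"
  obtain S where S: "S \<subseteq> {..<5}" "\<sigma> = edge ` S"
    using assms by (auto simp: scarf_sets_def elim: subset_cycle_edges)
  have "\<forall>S\<in>Pow {0, 1, 2, 3, 4}. 3 \<le> card S \<longrightarrow>
      (\<exists>T\<in>insert {0, 1, 2, 3, 4} ((\<lambda>i. S - {i}) ` S). T \<noteq> S \<and> verts T = verts S)"
    by code_simp
  then have "3 \<le> card S \<longrightarrow>
      (\<exists>T\<in>insert {..<5} ((\<lambda>i. S - {i}) ` S). T \<noteq> S \<and> verts T = verts S)"
    unfolding less5[symmetric] by (rule bspec) (use S(1) in simp)
  moreover have "3 \<le> card S" using S c by (simp add: card_edge_image)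
  ultimately have "\<exists>T\<in>insert {..<5} ((\<lambda>i. S - {i}) ` S). T \<noteq> S \<and> verts T = verts S" by (rule mp)
  then obtain T where T: "T \<in> insert {..<5} ((\<lambda>i. S - {i}) ` S)" "T \<noteq> S" "verts T = verts S"
    by (elim bexE conjE)
  have "T \<subseteq> {..<5}" using T(1) S(1) by blast
  then have "edge ` T \<subseteq> cycle_edges" "edge ` T \<noteq> \<sigma>" "mono_lcm (edge ` T) = mono_lcm \<sigma>"
    using S T \<open>T \<subseteq> {..<5}\<close> by (auto simp: cycle_edges_def edge_image_eq_iff lcm_edges_eq_iff)
  then show False using assms by (auto simp: scarf_sets_def)
qed

section \<open>Lyubeznik resolutions of the five-cycle\<close>

text \<open>An independent set of the five-cycle has at most two elements, and two non-adjacent elements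
  are at distance two. Here \<open>L\<close> is the independent set.\<close>

lemma ex_common_neighbour:
  assumes "\<And>m. m < 5 \<Longrightarrow> \<not> (L m \<and> L (cyc_next m))"
  shows "\<exists>x<5. \<forall>m<5. L m \<longrightarrow> x = cyc_prev m \<or> x = cyc_next m"
proof -
  have nexts: "cyc_next 0 = 1" "cyc_next 1 = 2" "cyc_next 2 = 3" "cyc_next 3 = 4" "cyc_next 4 = 0"
    by (simp_all add: cyc_next_def)
  have "\<not> (L 0 \<and> L 1)" "\<not> (L 1 \<and> L 2)" "\<not> (L 2 \<and> L 3)" "\<not> (L 3 \<and> L 4)" "\<not> (L 4 \<and> L 0)"
    using assms[of 0] assms[of 1] assms[of 2] assms[of 3] assms[of 4]
    unfolding nexts by simp_all
  then have "\<exists>x\<in>{..<5}. \<forall>m\<in>{..<5}. L m \<longrightarrow> x = cyc_prev m \<or> x = cyc_next m"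
    unfolding less5 by (simp add: cyc_prev_def cyc_next_def) blast
  then show ?thesis by auto
qed

text \<open>The smallest edge divides the lcm of its two neighbours, which both lie above it.\<close>

lemma lyub_cycle_not_critical:
  assumes gt: "strict_linear_order_on cycle_edges gt"
  shows "cycle_edges \<notin> critical cycle_edges (lyub_matching cycle_edges gt)"
proof -
  let ?G = cycle_edges
  note o = strict_linear_orderD[OF gt]
  have ne: "?G \<noteq> {}" using card_cycle_edges by auto
  obtain i where i: "i < 5" "smallest gt ?G = edge i"
    using smallest_props(1)[OF gt finite_cycle_edges ne] by (auto simp: cycle_edges_def)
  have min: "(q, edge i) \<in> gt" if "q \<in> ?G" "q \<noteq> edge i" for q
    using smallest_props(2)[OF gt finite_cycle_edges ne] that i by auto
  let ?a = "edge (cyc_prev i)" and ?b = "edge (cyc_next i)"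
  note n = cyc_next_prev[OF i(1)]
  have ab: "?a \<in> ?G" "?b \<in> ?G" "?a \<noteq> ?b" "?a \<noteq> edge i" "?b \<noteq> edge i"
    using n i by (auto simp: cycle_edges_def edge_eq_iff)
  \<comment> \<open>\<open>p\<close> is the smaller one of the two neighbours of edge \<open>i\<close>, so that the part above \<open>p\<close> contains both.\<close>
  obtain p where p: "p = ?a \<or> p = ?b" "?a \<in> upper_part gt ?G p" "?b \<in> upper_part gt ?G p"
    using ab o(3) unfolding total_on_def upper_part_def by blast
  then have "p \<in> ?G" "(p, edge i) \<in> gt" "edge i \<in> ?G"
    using ab min i by (auto simp: cycle_edges_def)
  moreover have "mono_dvd (edge i) (mono_lcm (upper_part gt ?G p))"
    using edge_dvd_lcm_iff[OF upper_part_subset i(1)] p by blast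
  ultimately show ?thesis
    unfolding critical_lyub_matching[OF gt finite_cycle_edges] by blast
qed

text \<open>If an edge \<open>i\<close> below \<open>p\<close> divides the lcm of the part of \<open>\<sigma>\<close> above \<open>p\<close>, then both neighbours of \<open>i\<close> are
  in that part. So \<open>i\<close> is a local minimum of the order both of whose neighbours belong to \<open>\<sigma>\<close>.
  The edge \<open>x\<close> missing from \<open>\<sigma>\<close> is chosen to be a neighbour of every local minimum.\<close>

lemma lyub_cycle_critical_4:
  assumes gt: "strict_linear_order_on cycle_edges gt"
  shows "\<exists>\<sigma>\<in>critical cycle_edges (lyub_matching cycle_edges gt). card \<sigma> = 4"
proof -
  let ?G = cycle_edges
  note o = strict_linear_orderD[OF gt]
  \<comment> \<open>the edges that are local minima\<close>
  define L where "L m \<longleftrightarrow> (edge (cyc_prev m), edge m) \<in> gt \<and> (edge (cyc_next m), edge m) \<in> gt" for m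
  have "\<not> (L m \<and> L (cyc_next m))" if "m < 5" for m
    using cyc_next_prev(6)[OF that] o(4) by (auto simp: L_def)
  then obtain x where x: "x < 5" "\<And>m. m < 5 \<Longrightarrow> L m \<Longrightarrow> x = cyc_prev m \<or> x = cyc_next m"
    using ex_common_neighbour[of L] by blast
  let ?\<sigma> = "?G - {edge x}"
  have "edge x \<in> ?G" using x by (simp add: cycle_edges_def)
  then have "card ?\<sigma> = 4" by (simp add: card_cycle_edges finite_cycle_edges)
  moreover have "\<not> mono_dvd m (mono_lcm (upper_part gt ?\<sigma> p))"
    if p: "p \<in> ?\<sigma>" and m: "m \<in> ?G" "(p, m) \<in> gt" for p m
  proof
    assume dvd: "mono_dvd m (mono_lcm (upper_part gt ?\<sigma> p))"
    obtain i where i: "i < 5" "m = edge i" using m by (auto simp: cycle_edges_def)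
    have "upper_part gt ?\<sigma> p \<subseteq> ?G" using upper_part_subset[of gt ?\<sigma> p] by blast
    from edge_dvd_lcm_iff[OF this i(1)] dvd i(2)
    have "edge i \<in> upper_part gt ?\<sigma> p \<or>
        edge (cyc_prev i) \<in> upper_part gt ?\<sigma> p \<and> edge (cyc_next i) \<in> upper_part gt ?\<sigma> p" by simp
    moreover have below: "q \<noteq> edge x \<and> (q, edge i) \<in> gt" if "q \<in> upper_part gt ?\<sigma> p" for q
      using that m(2) o(6) i by (auto simp: upper_part_def)
    ultimately have "L i" "edge (cyc_prev i) \<noteq> edge x" "edge (cyc_next i) \<noteq> edge x"
      using o(5) by (auto simp: L_def)
    then show False using x(2)[OF i(1)] by auto
  qed
  ultimately show ?thesis
    unfolding critical_lyub_matching[OF gt finite_cycle_edges] by blast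
qed

section \<open>A minimal Barile-Macchia resolution of the five-cycle\<close>

text \<open>A pair means that its first component is the larger one, so the smallest edge of a set is the
  one with the largest index.\<close>

definition index_order :: "mono rel" where
  "index_order = {(edge i, edge j) | i j. i < j \<and> j < 5}"

lemma index_order_iff:
  assumes "i < 5" "j < 5"
  shows "(edge i, edge j) \<in> index_order \<longleftrightarrow> i < j"
proof
  assume "(edge i, edge j) \<in> index_order"
  then obtain a b where ab: "edge i = edge a" "edge j = edge b" "a < b" "b < 5"
    unfolding index_order_def by blast
  then have "i = a" "j = b" using assms edge_eq_iff[of i a] edge_eq_iff[of j b] by simp_all
  then show "i < j" using ab by simp
qed (use assms in \<open>auto simp: index_order_def\<close>)

lemma index_order_linear: "strict_linear_order_on cycle_edges index_order"
proof -
  have "trans index_order"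
  proof (rule transI)
    fix a b c assume "(a, b) \<in> index_order" "(b, c) \<in> index_order"
    then obtain i j j' k where *: "a = edge i" "b = edge j" "i < j" "j < 5" "b = edge j'" "c = edge k" "j' < k" "k < 5"
      unfolding index_order_def by blast
    then have "j = j'" using edge_eq_iff[of j j'] by simp
    with * show "(a, c) \<in> index_order" using index_order_iff[of i k] by simp
  qed
  moreover have "irrefl index_order"
    by (auto simp: irrefl_def index_order_def edge_eq_iff)
  moreover have "total_on cycle_edges index_order"
    by (auto simp: total_on_def cycle_edges_def index_order_iff edge_eq_iff)
  ultimately show ?thesis by (simp add: strict_linear_order_on_def)
qed

definition bridge_indices :: "nat set \<Rightarrow> nat set" where
  "bridge_indices S = {i \<in> S. cyc_prev i \<in> S \<and> cyc_next i \<in> S}"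

definition sb_index :: "nat set \<Rightarrow> nat set" where
  "sb_index S = (if bridge_indices S = {} then {} else {Max (bridge_indices S)})"

text \<open>Dropping edge \<open>i\<close> uncovers an end point unless the neighbour at that end is present.\<close>

lemma verts_remove_eq_iff:
  assumes S: "S \<subseteq> {..<5}" and i: "i \<in> S"
  shows "verts (S - {i}) = verts S \<longleftrightarrow> cyc_prev i \<in> S \<and> cyc_next i \<in> S"
proof -
  have i5: "i < 5" using S i by auto
  have "insert i (S - {i}) = S" using i by blast
  then have S_eq: "verts S = {i, cyc_next i} \<union> verts (S - {i})" by (auto simp: verts_def)
  have "verts (S - {i}) = verts S \<longleftrightarrow> i \<in> verts (S - {i}) \<and> cyc_next i \<in> verts (S - {i})"
    unfolding S_eq by blast
  also have "i \<in> verts (S - {i}) \<longleftrightarrow> cyc_prev i \<in> S"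
    using mem_verts_iff[of "S - {i}" i] S i5 cyc_next_prev(4)[OF i5] by blast
  also have "cyc_next i \<in> verts (S - {i}) \<longleftrightarrow> cyc_next i \<in> S"
    using mem_verts_iff[of "S - {i}" "cyc_next i", unfolded cyc_next_prev(6)[OF i5]] S cyc_next_prev(1,3)[OF i5] by blast
  finally show ?thesis .
qed

lemma bridges_edges:
  assumes S: "S \<subseteq> {..<5}"
  shows "bridges (edge ` S) = edge ` bridge_indices S"
proof -
  have "mono_lcm (edge ` S - {edge i}) = mono_lcm (edge ` S) \<longleftrightarrow> cyc_prev i \<in> S \<and> cyc_next i \<in> S" if "i \<in> S" for i
  proof -
    have "edge ` S - {edge i} = edge ` (S - {i})"
      using inj_on_image_set_diff[OF inj_edge, of S "{i}"] that S by auto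
    then show ?thesis
      using lcm_edges_eq_iff[of "S - {i}" S] verts_remove_eq_iff[OF S that] S by auto
  qed
  then show ?thesis by (auto simp: bridges_def bridge_indices_def)
qed

lemma sb_edges:
  assumes S: "S \<subseteq> {..<5}"
  shows "sb index_order (edge ` S) = edge ` sb_index S"
proof (cases "bridge_indices S = {}")
  case False
  let ?B = "bridge_indices S"
  have B: "?B \<subseteq> {..<5}" using S by (auto simp: bridge_indices_def)
  then have fin: "finite ?B" using finite_subset by blast
  note o = strict_linear_orderD[OF index_order_linear]
  have "smallest index_order (edge ` ?B) = edge (Max ?B)"
  proof (rule smallest_eqI[OF o(1,2)])
    show "edge (Max ?B) \<in> edge ` ?B" using Max_in[OF fin False] by blast
    fix m assume "m \<in> edge ` ?B" "m \<noteq> edge (Max ?B)"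
    then obtain i where i: "i \<in> ?B" "m = edge i" "i \<noteq> Max ?B" by blast
    then have "i < Max ?B" using Max_ge[OF fin i(1)] by simp
    moreover have "Max ?B < 5" using Max_in[OF fin False] B by blast
    ultimately show "(m, edge (Max ?B)) \<in> index_order" using i by (simp add: index_order_iff)
  qed
  then show ?thesis using False by (simp add: sb_def sb_index_def bridges_edges[OF S])
qed (simp add: sb_def sb_index_def bridges_edges[OF S])

definition bm_target :: "nat set \<Rightarrow> nat set" where
  "bm_target S = S - sb_index S"

lemma target_edges:
  assumes S: "S \<subseteq> {..<5}"
  shows "edge ` S - sb index_order (edge ` S) = edge ` bm_target S"
proof -
  have "sb_index S \<subseteq> S"
  proof (cases "bridge_indices S = {}")
    case False
    have sub: "bridge_indices S \<subseteq> S" by (auto simp: bridge_indices_def)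
    then have "finite (bridge_indices S)" using S by (meson finite_lessThan finite_subset)
    then have "Max (bridge_indices S) \<in> S" using Max_in False sub by blast
    then show ?thesis by (simp add: sb_index_def)
  qed (simp add: sb_index_def)
  then show ?thesis
    unfolding sb_edges[OF S] bm_target_def using inj_on_image_set_diff[OF inj_edge, of S "sb_index S"] S by auto
qed

text \<open>The sets that the algorithm picks. The other five sets of cardinality at least 3 are targets:
  \<open>{0,1,2,3}\<close> of the full set, and \<open>{1,2,4}\<close>, \<open>{0,2,3}\<close>, \<open>{0,1,3}\<close>, \<open>{0,2,4}\<close> of the four sets of
  cardinality 4 in the order listed. All picked sets except \<open>{1,3,4}\<close> have a bridge.\<close>

definition bm_processed :: "nat set set" where
  "bm_processed = {{0,1,2,3,4}, {1,2,3,4}, {0,2,3,4}, {0,1,3,4}, {0,1,2,4},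
     {0,1,2}, {1,2,3}, {2,3,4}, {0,3,4}, {0,1,4}, {1,3,4}}"

definition bm_sources :: "nat set set" where
  "bm_sources = {S \<in> bm_processed. sb_index S \<noteq> {}}"

text \<open>These finite checks cover the hypotheses of \<open>bm_state_processed\<close>, the distinctness of the targets,
  and the critical sets: \<open>[0, 2, 3, 5]\<close> lists the numbers of vertices covered by critical sets of
  cardinality 0, 1, 2 and 3.\<close>

lemma bm_processed_table:
  shows bm_processed_sub: "\<forall>S\<in>bm_processed. S \<in> Pow {0,1,2,3,4} \<and> 3 \<le> card S"
    and bm_processed_cover: "\<forall>S\<in>Pow {0,1,2,3,4}. 3 \<le> card S \<and> S \<notin> bm_processed \<longrightarrow> (\<exists>T\<in>bm_processed. S = bm_target T)"
    and bm_processed_excl: "\<forall>S\<in>bm_processed. \<forall>T\<in>bm_processed. T \<noteq> S \<longrightarrow> T \<noteq> bm_target S"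
    and bm_sources_inj: "\<forall>S\<in>bm_sources. \<forall>T\<in>bm_sources. bm_target S = bm_target T \<longrightarrow> S = T"
    and bm_critical: "\<forall>S\<in>Pow {0,1,2,3,4}. (\<forall>T\<in>bm_sources. S \<noteq> T \<and> S \<noteq> bm_target T) \<longrightarrow>
         card S \<le> 3 \<and> card (verts S) = [0, 2, 3, 5] ! card S"
    and bm_critical_3: "\<forall>T\<in>bm_sources. {1,3,4} \<noteq> T \<and> {1,3,4} \<noteq> bm_target T"
  by code_simp+

definition cycle_matching :: "(mono set \<times> mono set) set" where
  "cycle_matching = (\<lambda>S. (edge ` S, edge ` bm_target S)) ` bm_sources"

lemma bm_sources_sub: "S \<in> bm_sources \<Longrightarrow> S \<subseteq> {..<5} \<and> bm_target S \<subseteq> {..<5}"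
  using bm_processed_sub by (auto simp: bm_sources_def bm_target_def less5)

lemma bm_matching_cycle: "bm_matching cycle_edges index_order cycle_matching"
proof -
  let ?P = "(`) edge ` bm_processed"
  have sub: "S \<subseteq> {..<5}" "3 \<le> card S" if "S \<in> bm_processed" for S
    using bm_processed_sub that by (auto simp: less5)
  have "bm_state cycle_edges index_order {}
      {(p, p - sb index_order p) | p. p \<in> ?P \<and> sb index_order p \<noteq> {}}"
  proof (rule bm_state_processed[OF finite_cycle_edges])
    show "?P \<subseteq> {\<sigma>. \<sigma> \<subseteq> cycle_edges \<and> 3 \<le> card \<sigma>}"
      using sub by (auto simp: cycle_edges_def card_edge_image)
  next
    fix \<sigma> assume s: "\<sigma> \<subseteq> cycle_edges" "3 \<le> card \<sigma>" "\<sigma> \<notin> ?P"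
    obtain S where S: "S \<subseteq> {..<5}" "\<sigma> = edge ` S" using s(1) by (rule subset_cycle_edges)
    then have "S \<in> Pow {0,1,2,3,4}" "3 \<le> card S" "S \<notin> bm_processed"
      using s by (auto simp: less5 card_edge_image)
    then obtain T where T: "T \<in> bm_processed" "S = bm_target T" using bm_processed_cover by blast
    then have "\<sigma> = edge ` T - sb index_order (edge ` T)"
      using target_edges[OF sub(1)] S(2) by simp
    then show "\<exists>p\<in>?P. \<sigma> = p - sb index_order p" using T(1) by blast
  next
    fix p q assume "p \<in> ?P" "q \<in> ?P" "q \<noteq> p"
    then obtain S T where ST: "S \<in> bm_processed" "p = edge ` S" "T \<in> bm_processed" "q = edge ` T" "T \<noteq> S"
      by blast
    then have "T \<noteq> bm_target S" using bm_processed_excl by blast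
    moreover have "bm_target S \<subseteq> {..<5}" using sub[OF ST(1)] by (auto simp: bm_target_def)
    ultimately show "q \<noteq> p - sb index_order p"
      using ST sub target_edges[of S] edge_image_eq_iff[of T "bm_target S"] by simp
  qed
  also have "{(p, p - sb index_order p) | p. p \<in> ?P \<and> sb index_order p \<noteq> {}} = cycle_matching"
  proof -
    have "{(p, p - sb index_order p) | p. p \<in> ?P \<and> sb index_order p \<noteq> {}} =
        (\<lambda>S. (edge ` S, edge ` S - sb index_order (edge ` S))) ` {S \<in> bm_processed. sb index_order (edge ` S) \<noteq> {}}"
      by blast
    also have "\<dots> = cycle_matching"
      unfolding cycle_matching_def bm_sources_def
    proof (rule image_cong)
      show "{S \<in> bm_processed. sb index_order (edge ` S) \<noteq> {}} = {S \<in> bm_processed. sb_index S \<noteq> {}}"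
        using sub by (auto simp: sb_edges)
    qed (use sub in \<open>simp add: target_edges\<close>)
    finally show ?thesis .
  qed
  finally have "bm_state cycle_edges index_order {} cycle_matching" .
  moreover have "inj_on snd cycle_matching"
    using bm_sources_inj bm_sources_sub by (auto simp: inj_on_def cycle_matching_def edge_image_eq_iff)
  ultimately show ?thesis
    unfolding bm_matching_def using bm_prune_inj by metis
qed

lemma critical_cycle_matching_iff:
  assumes "S \<subseteq> {..<5}"
  shows "edge ` S \<in> critical cycle_edges cycle_matching \<longleftrightarrow> (\<forall>T\<in>bm_sources. S \<noteq> T \<and> S \<noteq> bm_target T)"
  using assms bm_sources_sub
  by (auto simp: critical_def cycle_matching_def cycle_edges_def edge_image_eq_iff)

lemma critical_cycle_matching:
  assumes "\<sigma> \<in> critical cycle_edges cycle_matching"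
  obtains S where "S \<subseteq> {..<5}" "\<sigma> = edge ` S" "card \<sigma> \<le> 3" "card (verts S) = [0, 2, 3, 5] ! card \<sigma>"
proof -
  have "\<sigma> \<subseteq> cycle_edges" using assms by (simp add: critical_def)
  then obtain S where S: "S \<subseteq> {..<5}" "\<sigma> = edge ` S" by (rule subset_cycle_edges)
  then have "card S \<le> 3 \<and> card (verts S) = [0, 2, 3, 5] ! card S"
    using assms bm_critical critical_cycle_matching_iff[OF S(1)] by (simp add: less5)
  then show ?thesis using that S by (simp add: card_edge_image)
qed

lemma critical_cycle_matching_3: "edge ` {1,3,4} \<in> critical cycle_edges cycle_matching"
  using critical_cycle_matching_iff[of "{1,3,4}"] bm_critical_3 by simp

text \<open>A critical set covers more vertices than a critical set with one element less, so its lcm does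
  not divide the lcm of the latter.\<close>

lemma minimal_cycle_matching:
  "minimal_complex (mpoly_ring 5) (irrelevant_ideal 5 :: 'k::field mpoly set)
     (morse_complex 5 cycle_edges gt cycle_matching)"
proof (rule minimal_morse_complex[OF finite_cycle_edges lcm_cycle_edges_monomials])
  fix \<sigma> \<tau> assume st: "\<sigma> \<in> critical cycle_edges cycle_matching" "\<tau> \<in> critical cycle_edges cycle_matching"
     "card \<sigma> = Suc (card \<tau>)"
  obtain S where S: "S \<subseteq> {..<5}" "\<sigma> = edge ` S" "card \<sigma> \<le> 3" "card (verts S) = [0, 2, 3, 5] ! card \<sigma>"
    using st(1) by (rule critical_cycle_matching)
  obtain T where T: "T \<subseteq> {..<5}" "\<tau> = edge ` T" "card \<tau> \<le> 3" "card (verts T) = [0, 2, 3, 5] ! card \<tau>"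
    using st(2) by (rule critical_cycle_matching)
  have "card \<tau> = 0 \<or> card \<tau> = 1 \<or> card \<tau> = 2" using S(3) st(3) by linarith
  then have "card (verts T) < card (verts S)"
    unfolding S(4) T(4) st(3) by (auto simp: numeral_eq_Suc)
  moreover have "finite (verts T)" using T(1) finite_subset by (auto simp: verts_def)
  ultimately have "\<not> verts S \<subseteq> verts T" using card_mono leD by blast
  then show "\<not> mono_dvd (mono_lcm \<sigma>) (mono_lcm \<tau>)"
    using lcm_edges_dvd_iff S T by blast
qed

section \<open>The comparison of the four complexes\<close>

theorem theorem5p2:
  "\<exists>N (I :: 'k::field mpoly set) G.
     monomial_ideal N I \<and> minimal_generators N I G \<and>
     (let R = (mpoly_ring N :: 'k mpoly ring) in
      (\<forall>gt gt'. strict_linear_order_on G gt \<longrightarrow> strict_linear_order_on G gt' \<longrightarrow>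
         \<not> complex_iso R (taylor N G gt) (lyubeznik N G gt') \<and>
         \<not> complex_iso R (taylor N G gt) (scarf N G gt') \<and>
         \<not> complex_iso R (lyubeznik N G gt) (scarf N G gt')) \<and>
      (\<exists>gt B. strict_linear_order_on G gt \<and> barile_macchia N G gt B \<and>
         minimal_complex R (irrelevant_ideal N) B \<and>
         (\<forall>gt'. strict_linear_order_on G gt' \<longrightarrow>
            \<not> complex_iso R (taylor N G gt') B \<and>
            \<not> complex_iso R (lyubeznik N G gt') B \<and>
            \<not> complex_iso R (scarf N G gt') B)))"
proof -
  let ?G = cycle_edges
  let ?R = "mpoly_ring 5 :: 'k mpoly ring"
  let ?I = "Idl\<^bsub>?R\<^esub> (of_mono ` ?G) :: 'k mpoly set"
  let ?T = "\<lambda>gt. taylor 5 ?G gt :: ('k mpoly, mono set \<Rightarrow> 'k mpoly) module_complex"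
  let ?L = "\<lambda>gt. lyubeznik 5 ?G gt :: ('k mpoly, mono set \<Rightarrow> 'k mpoly) module_complex"
  let ?S = "\<lambda>gt. scarf 5 ?G gt :: ('k mpoly, mono set \<Rightarrow> 'k mpoly) module_complex"
  let ?B = "morse_complex 5 ?G index_order cycle_matching :: ('k mpoly, mono set \<Rightarrow> 'k mpoly) module_complex"
  \<comment> \<open>The lengths of the complexes. An isomorphism is then excluded in the top degree of the longer
    one.\<close>
  have taylor5: "{\<sigma>. \<sigma> \<subseteq> ?G \<and> card \<sigma> = 5} \<noteq> {}"
    using card_cycle_edges by blast
  have top: "{\<sigma> \<in> critical ?G A. card \<sigma> = 5} \<noteq> {} \<longleftrightarrow> ?G \<in> critical ?G A" for A
    using card_subset_eq[OF finite_cycle_edges] card_cycle_edges by (auto simp: critical_def)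
  have lyub5: "{\<sigma> \<in> critical ?G (lyub_matching ?G gt). card \<sigma> = 5} = {}"
    and lyub4: "{\<sigma> \<in> critical ?G (lyub_matching ?G gt). card \<sigma> = 4} \<noteq> {}"
    if "strict_linear_order_on ?G gt" for gt
    using lyub_cycle_not_critical[OF that] lyub_cycle_critical_4[OF that] top by blast+
  have scarf: "{\<sigma> \<in> scarf_sets ?G. card \<sigma> = r} = {}" if "r > 2" for r
    using scarf_sets_cycle_edges that by fastforce
  have "card \<sigma> \<le> 3" if "\<sigma> \<in> critical ?G cycle_matching" for \<sigma>
    using that by (rule critical_cycle_matching)
  then have bm: "{\<sigma> \<in> critical ?G cycle_matching. card \<sigma> = r} = {}" if "r > 3" for r
    using that by fastforce
  have bm3: "{\<sigma> \<in> critical ?G cycle_matching. card \<sigma> = 3} \<noteq> {}"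
    using critical_cycle_matching_3 card_edge_image[of "{1,3,4}"] by auto
  have num3: "(2::nat) < 3" and num4: "(2::nat) < 4" and num5: "(2::nat) < 5"
    and bnum4: "(3::nat) < 4" and bnum5: "(3::nat) < 5" by simp_all
  note iso = complex_iso_basis_empty_iff[where R = ?R and N = 5]
  have "\<not> complex_iso ?R (?T gt) (?L gt')" if "strict_linear_order_on ?G gt'" for gt gt'
    using iso[OF _ chain_mod_taylor chain_mod_lyubeznik, where r = 5] taylor5 lyub5[OF that] by blast
  moreover have "\<not> complex_iso ?R (?T gt) (?S gt')" for gt gt'
    using iso[OF _ chain_mod_taylor chain_mod_scarf, where r = 5] taylor5 scarf[of 5, OF num5] by blast
  moreover have "\<not> complex_iso ?R (?L gt) (?S gt')" if "strict_linear_order_on ?G gt" for gt gt'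
    using iso[OF _ chain_mod_lyubeznik chain_mod_scarf, where r = 4] lyub4[OF that] scarf[of 4, OF num4] by blast
  moreover have "\<not> complex_iso ?R (?T gt) ?B" for gt
    using iso[OF _ chain_mod_taylor chain_mod_morse, where r = 5] taylor5 bm[of 5, OF bnum5] by blast
  moreover have "\<not> complex_iso ?R (?L gt) ?B" if "strict_linear_order_on ?G gt" for gt
    using iso[OF _ chain_mod_lyubeznik chain_mod_morse, where r = 4] lyub4[OF that] bm[of 4, OF bnum4] by blast
  moreover have "\<not> complex_iso ?R (?S gt) ?B" for gt
    using iso[OF _ chain_mod_scarf chain_mod_morse, where r = 3] scarf[of 3, OF num3] bm3 by blast
  moreover have "barile_macchia 5 ?G index_order ?B"
    using bm_matching_cycle by (auto simp: barile_macchia_def)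
  moreover have "monomial_ideal 5 ?I"
    using cycle_edges_monomials by (auto simp: monomial_ideal_def)
  moreover have "minimal_generators 5 ?I ?G"
    by (rule minimal_generators_antichain[OF cycle_edges_monomials cycle_edges_antichain])
  ultimately show ?thesis
    using index_order_linear minimal_cycle_matching[of index_order, where 'k = 'k]
    by (intro exI[of _ 5] exI[of _ ?I] exI[of _ ?G]) (unfold Let_def, blast)
qed

end
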